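(* Let $V$ be a set of $n$ vertices and $p$ an integer with $0\le p\le n-2$. A $p$-Query-Scheme on $V$ of size $p^{\mathcal{O}(1)}\log n$ can be constructed (deterministically) in time $p^{\mathcal{O}(1)} n \log n$.
   Context: A witness is a tuple $(\{u,v\},\{w_1,\dots,w_p\})$ of distinct vertices $u,v,w_1,\dots,w_p\in V$. A family $\mathcal{Q}=\{Q_1,\dots,Q_\ell\}$ of subsets of $V$ is a $p$-Query-Scheme of size $\ell$ if for every witness $(\{u,v\},\{w_1,\dots,w_p\})$ there is $i$ with $u,v\in Q_i$ and $\{w_1,\dots,w_p\}\cap Q_i=\emptyset$. *)

theory Defs
  imports Complex_Main
begin

section \<open>Witnesses and query schemes\<close>

definition witness :: "'a set \<Rightarrow> nat \<Rightarrow> 'a set \<Rightarrow> 'a set \<Rightarrow> bool" where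
  "witness V p E W \<longleftrightarrow>
     (\<exists>u v ws. E = {u, v} \<and> W = set ws \<and> length ws = p \<and>
        distinct (u # v # ws) \<and> set (u # v # ws) \<subseteq> V)"

text \<open>The family is indexed, so it is a list; its size is the length of the list, which
  bounds the number of distinct members.\<close>

definition query_scheme :: "'a set \<Rightarrow> nat \<Rightarrow> 'a set list \<Rightarrow> bool" where
  "query_scheme V p Qs \<longleftrightarrow>
     (\<forall>i < length Qs. Qs ! i \<subseteq> V) \<and>
     (\<forall>E W. witness V p E W \<longrightarrow> (\<exists>i < length Qs. E \<subseteq> Qs ! i \<and> W \<inter> Qs ! i = {}))"


section \<open>A word RAM\<close>

text \<open>
  Time is measured on a unit-cost word RAM, presented as a structured language over finitely
  many registers and arrays (a program mentions only finitely many names, so the arrays can be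
  interleaved into a single memory). A word has \<open>w\<close> bits. Every value that arises during
  a computation, addresses and intermediate results included, has to be smaller than
  \<open>2 ^ w\<close>: a computation that overflows has no derivation in \<open>exec\<close>.
\<close>

record state =
  reg :: "string \<Rightarrow> nat"
  arr :: "string \<Rightarrow> nat \<Rightarrow> nat"

datatype binop = Plus | Minus | Times | Div | Mod | Less | Equal

datatype expr =
    Const nat
  | Reg string
  | Read string expr
  | Op binop expr expr

text \<open>Subtraction is truncated at 0; comparisons return 0 or 1.\<close>

fun binop_val :: "binop \<Rightarrow> nat \<Rightarrow> nat \<Rightarrow> nat" where
  "binop_val Plus x y = x + y"
| "binop_val Minus x y = x - y"
| "binop_val Times x y = x * y"
| "binop_val Div x y = x div y"
| "binop_val Mod x y = x mod y"
| "binop_val Less x y = (if x < y then 1 else 0)"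
| "binop_val Equal x y = (if x = y then 1 else 0)"

primrec expr_val :: "expr \<Rightarrow> state \<Rightarrow> nat" where
  "expr_val (Const k) s = k"
| "expr_val (Reg x) s = reg s x"
| "expr_val (Read a e) s = arr s a (expr_val e s)"
| "expr_val (Op f e1 e2) s = binop_val f (expr_val e1 s) (expr_val e2 s)"

primrec expr_fits :: "nat \<Rightarrow> expr \<Rightarrow> state \<Rightarrow> bool" where
  "expr_fits w (Const k) s \<longleftrightarrow> k < 2 ^ w"
| "expr_fits w (Reg x) s \<longleftrightarrow> reg s x < 2 ^ w"
| "expr_fits w (Read a e) s \<longleftrightarrow> expr_fits w e s \<and> expr_val (Read a e) s < 2 ^ w"
| "expr_fits w (Op f e1 e2) s \<longleftrightarrow>
     expr_fits w e1 s \<and> expr_fits w e2 s \<and> expr_val (Op f e1 e2) s < 2 ^ w"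

primrec expr_cost :: "expr \<Rightarrow> nat" where
  "expr_cost (Const k) = 1"
| "expr_cost (Reg x) = 1"
| "expr_cost (Read a e) = expr_cost e + 1"
| "expr_cost (Op f e1 e2) = expr_cost e1 + expr_cost e2 + 1"

datatype com =
    Skip
  | Assign string expr
  | Store string expr expr
  | Seq com com
  | Cond expr com com
  | While expr com

text \<open>\<open>exec w c s t s'\<close>: on words of \<open>w\<close> bits, \<open>c\<close> started in \<open>s\<close> halts in
  \<open>s'\<close> after exactly \<open>t\<close> elementary operations, without overflow.\<close>

inductive exec :: "nat \<Rightarrow> com \<Rightarrow> state \<Rightarrow> nat \<Rightarrow> state \<Rightarrow> bool" for w :: nat where
  Skip: "exec w Skip s 1 s"
| Assign: "expr_fits w e s \<Longrightarrow>
    exec w (Assign x e) s (expr_cost e + 1) (s\<lparr>reg := (reg s)(x := expr_val e s)\<rparr>)"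
| Store: "expr_fits w i s \<Longrightarrow> expr_fits w e s \<Longrightarrow>
    exec w (Store a i e) s (expr_cost i + expr_cost e + 1)
      (s\<lparr>arr := (arr s)(a := (arr s a)(expr_val i s := expr_val e s))\<rparr>)"
| Seq: "exec w c1 s t1 s1 \<Longrightarrow> exec w c2 s1 t2 s2 \<Longrightarrow>
    exec w (Seq c1 c2) s (t1 + t2) s2"
| CondTrue: "expr_fits w e s \<Longrightarrow> expr_val e s \<noteq> 0 \<Longrightarrow> exec w c1 s t s1 \<Longrightarrow>
    exec w (Cond e c1 c2) s (expr_cost e + 1 + t) s1"
| CondFalse: "expr_fits w e s \<Longrightarrow> expr_val e s = 0 \<Longrightarrow> exec w c2 s t s1 \<Longrightarrow>
    exec w (Cond e c1 c2) s (expr_cost e + 1 + t) s1"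
| WhileFalse: "expr_fits w e s \<Longrightarrow> expr_val e s = 0 \<Longrightarrow>
    exec w (While e c) s (expr_cost e + 1) s"
| WhileTrue: "expr_fits w e s \<Longrightarrow> expr_val e s \<noteq> 0 \<Longrightarrow>
    exec w c s t1 s1 \<Longrightarrow> exec w (While e c) s1 t2 s2 \<Longrightarrow>
    exec w (While e c) s (expr_cost e + 1 + t1 + t2) s2"

inductive_cases SkipE: "exec w Skip s t s'"
inductive_cases AssignE: "exec w (Assign x e) s t s'"
inductive_cases StoreE: "exec w (Store a i e) s t s'"
inductive_cases SeqE: "exec w (Seq c1 c2) s t s'"
inductive_cases CondE: "exec w (Cond e c1 c2) s t s'"
inductive_cases WhileE: "exec w (While e c) s t s'"

lemma exec_deterministic:
  "exec w c s t s' \<Longrightarrow> exec w c s u s'' \<Longrightarrow> u = t \<and> s'' = s'"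
proof (induction arbitrary: u s'' rule: exec.induct)
  case Skip
  then show ?case by (auto elim: SkipE)
next
  case Assign
  then show ?case by (auto elim: AssignE)
next
  case Store
  then show ?case by (auto elim: StoreE)
next
  case (Seq c1 s t1 s1 c2 t2 s2)
  from Seq.prems obtain u1 r1 u2 where
    "exec w c1 s u1 r1" "exec w c2 r1 u2 s''" "u = u1 + u2"
    by (rule SeqE)
  then show ?case using Seq.IH by metis
next
  case (CondTrue e s c1 t s1 c2)
  from CondTrue.prems obtain v where "exec w c1 s v s''" "u = expr_cost e + 1 + v"
    by (rule CondE) (use CondTrue.hyps in simp_all)
  then show ?case using CondTrue.IH by metis
next
  case (CondFalse e s c2 t s1 c1)
  from CondFalse.prems obtain v where "exec w c2 s v s''" "u = expr_cost e + 1 + v"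
    by (rule CondE) (use CondFalse.hyps in simp_all)
  then show ?case using CondFalse.IH by metis
next
  case (WhileFalse e s c)
  from WhileFalse.prems show ?case
    by (rule WhileE) (use WhileFalse.hyps in simp_all)
next
  case (WhileTrue e s c t1 s1 t2 s2)
  from WhileTrue.prems obtain u1 r1 u2 where
    "exec w c s u1 r1" "exec w (While e c) r1 u2 s''" "u = expr_cost e + 1 + u1 + u2"
    by (rule WhileE) (use WhileTrue.hyps in simp_all)
  then show ?case using WhileTrue.IH by metis
qed


section \<open>Input and output conventions\<close>

text \<open>The vertex set is handed over as an array listing its elements, in any order. All other
  memory is initially 0.\<close>

definition input_state :: "nat list \<Rightarrow> nat \<Rightarrow> state" where
  "input_state vs p =
     \<lparr>reg = (\<lambda>_. 0)(''n'' := length vs, ''p'' := p),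
      arr = (\<lambda>_ _. 0)(''V'' := (\<lambda>i. if i < length vs then vs ! i else 0))\<rparr>"

text \<open>The family is written out explicitly: array \<open>Q\<close> lists the elements of the first
  set, then those of the second set, and so on, and the \<open>i\<close>-th set occupies the positions
  from \<open>off i\<close> up to, but excluding, \<open>off (i + 1)\<close>.\<close>

definition outputs_family :: "state \<Rightarrow> nat set list \<Rightarrow> bool" where
  "outputs_family s Qs \<longleftrightarrow>
     reg s ''size'' = length Qs \<and>
     arr s ''off'' 0 = 0 \<and>
     (\<forall>i < length Qs.
        arr s ''off'' i \<le> arr s ''off'' (i + 1) \<and>
        Qs ! i = arr s ''Q'' ` {arr s ''off'' i ..< arr s ''off'' (i + 1)})"

end

theory Submission
  imports Defs
begin

text \<open>
  Let \<open>q = 2 ^ r\<close> and \<open>2 ^ K\<close> be the least powers of 2 with \<open>q > 6 p\<close> and \<open>2 ^ K \<ge> n\<close>, and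
  identify the vertices with indices below \<open>2 ^ K\<close>. Given \<open>q K\<close> maps \<open>F\<close> from \<open>{..<2 ^ K}\<close> to
  \<open>{..<q}\<close>, linear with respect to exclusive or, take for every \<open>F\<close> and all \<open>a, b < q\<close> the set of
  vertices \<open>x\<close> with \<open>F x \<in> {a, b}\<close>. A map \<open>F\<close> serves a witness unless some \<open>w\<^sub>i\<close> collides with
  \<open>u\<close> or \<open>v\<close>, and by linearity \<open>x\<close> and \<open>y\<close> collide iff \<open>F\<close> vanishes at \<open>x XOR y\<close>. So it
  suffices that every \<open>d > 0\<close> is a zero of at most \<open>3 K\<close> of the maps: then at most
  \<open>2 p \<sqdot> 3 K < q K\<close> maps fail. Linearity is what makes the greedy choice cheap, as only the
  \<open>2 ^ K\<close> differences \<open>d\<close> have to be watched instead of all pairs.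

  Give \<open>d\<close> the weight \<open>2\<close> to the number of its zeros so far. A new map is fixed by its values at
  \<open>2 ^ i\<close>, \<open>i < K\<close>; for \<open>y < 2 ^ i\<close> the value at \<open>2 ^ i + y\<close> is \<open>F y XOR b\<close> with \<open>b\<close> the value
  at \<open>2 ^ i\<close>, so exactly one of the \<open>q\<close> choices of \<open>b\<close> makes it vanish. Choosing \<open>b\<close> to double
  the least weight multiplies the total weight by at most \<open>1 + 1 / q\<close>. After \<open>q K\<close> maps the total
  is at most \<open>2 ^ K \<sqdot> (1 + 1 / q) ^ (q K) \<le> 8 ^ K\<close>, whence the bound \<open>3 K\<close>.
\<close>

unbundle bit_operations_syntax

section \<open>Weakest preconditions with running times\<close>

text \<open>Total correctness with the running time passed to the postcondition; a derivation exists
  only without overflow, so word-size checks are included. As \<open>exec\<close> is deterministic,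
  asking for one run loses nothing, and the rules for loop-free commands are equivalences usable as
  rewrite rules.\<close>

definition wp :: "nat \<Rightarrow> com \<Rightarrow> (nat \<Rightarrow> state \<Rightarrow> bool) \<Rightarrow> state \<Rightarrow> bool" where
  "wp w c Q s \<longleftrightarrow> (\<exists>t s'. exec w c s t s' \<and> Q t s')"

lemma wp_Skip: "wp w Skip Q s \<longleftrightarrow> Q 1 s"
  unfolding wp_def by (metis exec.Skip exec_deterministic)

lemma wp_Assign:
  "wp w (Assign x e) Q s \<longleftrightarrow>
     expr_fits w e s \<and> Q (expr_cost e + 1) (s\<lparr>reg := (reg s)(x := expr_val e s)\<rparr>)"
proof -
  have "exec w (Assign x e) s t s' \<longleftrightarrow> expr_fits w e s \<and> t = expr_cost e + 1 \<and>
      s' = s\<lparr>reg := (reg s)(x := expr_val e s)\<rparr>" for t s'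
    by (metis AssignE exec.Assign)
  then show ?thesis unfolding wp_def by simp
qed

lemma wp_Store:
  "wp w (Store a i e) Q s \<longleftrightarrow>
     expr_fits w i s \<and> expr_fits w e s \<and> Q (expr_cost i + expr_cost e + 1)
       (s\<lparr>arr := (arr s)(a := (arr s a)(expr_val i s := expr_val e s))\<rparr>)"
proof -
  have "exec w (Store a i e) s t s' \<longleftrightarrow> expr_fits w i s \<and> expr_fits w e s \<and>
      t = expr_cost i + expr_cost e + 1 \<and>
      s' = s\<lparr>arr := (arr s)(a := (arr s a)(expr_val i s := expr_val e s))\<rparr>" for t s'
    by (metis StoreE exec.Store)
  then show ?thesis unfolding wp_def by simp
qed

lemma wp_Seq: "wp w (Seq c1 c2) Q s \<longleftrightarrow> wp w c1 (\<lambda>t1. wp w c2 (\<lambda>t2. Q (t1 + t2))) s"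
  unfolding wp_def by (blast elim: SeqE intro: exec.Seq)

lemma wp_Cond:
  "wp w (Cond e c1 c2) Q s \<longleftrightarrow> expr_fits w e s \<and>
     (if expr_val e s \<noteq> 0 then wp w c1 (\<lambda>t. Q (expr_cost e + 1 + t)) s
      else wp w c2 (\<lambda>t. Q (expr_cost e + 1 + t)) s)"
proof (cases "expr_val e s = 0")
  case True
  then have "exec w (Cond e c1 c2) s t s' \<longleftrightarrow> expr_fits w e s \<and>
      (\<exists>u. exec w c2 s u s' \<and> t = expr_cost e + 1 + u)" for t s'
    by (auto elim: CondE intro: exec.CondFalse[where w = w, simplified])
  with True show ?thesis unfolding wp_def by auto
next
  case False
  then have "exec w (Cond e c1 c2) s t s' \<longleftrightarrow> expr_fits w e s \<and>
      (\<exists>u. exec w c1 s u s' \<and> t = expr_cost e + 1 + u)" for t s'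
    by (auto elim: CondE intro: exec.CondTrue[where w = w, simplified])
  with False show ?thesis unfolding wp_def by auto
qed

lemmas wp_simps = wp_Skip wp_Assign wp_Store wp_Seq wp_Cond

lemma wp_mono: "wp w c Q s \<Longrightarrow> (\<And>t s'. Q t s' \<Longrightarrow> R t s') \<Longrightarrow> wp w c R s"
  unfolding wp_def by blast

text \<open>The number \<open>N\<close> of rounds is fixed beforehand and the invariant is indexed
  by the round, so termination and time need no separate measure. The bound \<open>T k\<close> may
  vary with the round, which lets loops with geometrically growing bodies be summed exactly.\<close>

lemma wp_While:
  fixes T :: "nat \<Rightarrow> nat"
  assumes "I 0 s"
    and step: "\<And>k s. k < N \<Longrightarrow> I k s \<Longrightarrow> expr_fits w e s \<and> expr_val e s \<noteq> 0 \<and>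
      wp w c (\<lambda>t s'. t \<le> T k \<and> I (Suc k) s') s"
    and final: "\<And>s. I N s \<Longrightarrow> expr_fits w e s \<and> expr_val e s = 0"
    and post: "\<And>t s'. t \<le> (\<Sum>k<N. T k + (expr_cost e + 1)) + (expr_cost e + 1) \<Longrightarrow> I N s' \<Longrightarrow> Q t s'"
  shows "wp w (While e c) Q s"
proof -
  \<comment> \<open>Generalised to a start in round \<open>i\<close>, so that the induction can run
    downwards from \<open>N\<close>.\<close>
  have "\<exists>t s'. exec w (While e c) s t s' \<and> I N s' \<and>
          t \<le> (\<Sum>k\<in>{i..<N}. T k + (expr_cost e + 1)) + (expr_cost e + 1)"
    if "i \<le> N" "I i s" for i s
    using that
  proof (induction i arbitrary: s rule: inc_induct)
    case base
    with final[OF base] show ?case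
      by (intro exI[of _ "expr_cost e + 1"] exI[of _ s]) (simp del: One_nat_def add_Suc_right add: exec.WhileFalse)
  next
    case (step i)
    from assms(2)[OF step.hyps(2) step.prems] obtain t s1
      where fv: "expr_fits w e s" "expr_val e s \<noteq> 0"
        and s1: "exec w c s t s1" "t \<le> T i" "I (Suc i) s1"
      unfolding wp_def by blast
    from step.IH[OF s1(3)] obtain u s2 where s2: "exec w (While e c) s1 u s2" "I N s2"
      "u \<le> (\<Sum>k\<in>{Suc i..<N}. T k + (expr_cost e + 1)) + (expr_cost e + 1)"
      by blast
    have "(\<Sum>k\<in>{i..<N}. T k + (expr_cost e + 1)) =
        T i + (expr_cost e + 1) + (\<Sum>k\<in>{Suc i..<N}. T k + (expr_cost e + 1))"
      using step.hyps by (simp add: sum.atLeast_Suc_lessThan)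
    with s1 s2 exec.WhileTrue[OF fv s1(1) s2(1)] show ?case
      by (intro exI[of _ "expr_cost e + 1 + t + u"] exI[of _ s2]) auto
  qed
  from this[of 0 s] assms(1) post show ?thesis
    unfolding wp_def by (auto simp: lessThan_atLeast0)
qed

definition For :: "string \<Rightarrow> expr \<Rightarrow> com \<Rightarrow> com" where
  "For x e c = Seq (Assign x (Const 0))
     (While (Op Less (Reg x) e) (Seq c (Assign x (Op Plus (Reg x) (Const 1)))))"

text \<open>Each round adds \<open>expr_cost e + 3\<close> for the guard and 4 for the increment;
  outside the rounds there remain the failing guard and 2 for the initialisation. The bound
  \<open>e\<close> is evaluated anew in every round, hence the premise that it keeps the value
  \<open>N\<close>.\<close>

lemma wp_For:
  fixes T :: "nat \<Rightarrow> nat"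
  assumes N: "N < 2 ^ w"
    and init: "I 0 (s\<lparr>reg := (reg s)(x := 0)\<rparr>)"
    and guard: "\<And>k s. k \<le> N \<Longrightarrow> reg s x = k \<Longrightarrow> I k s \<Longrightarrow> expr_fits w e s \<and> expr_val e s = N"
    and body: "\<And>k s. k < N \<Longrightarrow> reg s x = k \<Longrightarrow> I k s \<Longrightarrow> wp w c (\<lambda>t s'. t \<le> T k \<and>
      reg s' x = k \<and> I (Suc k) (s'\<lparr>reg := (reg s')(x := Suc k)\<rparr>)) s"
    and post: "\<And>t s'. t \<le> (\<Sum>k<N. T k + (expr_cost e + 7)) + (expr_cost e + 5) \<Longrightarrow>
      reg s' x = N \<Longrightarrow> I N s' \<Longrightarrow> Q t s'"
  shows "wp w (For x e c) Q s"
proof -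
  \<comment> \<open>The constant 1 of the increment is evaluated only if the body runs, and then
    \<open>1 \<le> N < 2 ^ w\<close>.\<close>
  have one: "1 < (2::nat) ^ w" if "0 < N"
    using that N by linarith
  show ?thesis
    unfolding For_def wp_Seq wp_Assign
  proof (intro conjI, simp, rule wp_While[where I = "\<lambda>k s. reg s x = k \<and> I k s" and N = N and T = "\<lambda>k. T k + 4"],
      goal_cases)
    case 1
    then show ?case using init by simp
  next
    case (2 k s)
    have "wp w c (\<lambda>t s'. t \<le> T k \<and> reg s' x = k \<and> I (Suc k) (s'\<lparr>reg := (reg s')(x := Suc k)\<rparr>)) s"
      using body[of k s] 2 by blast
    then have "wp w (Seq c (Assign x (Op Plus (Reg x) (Const 1))))
        (\<lambda>t s'. t \<le> T k + 4 \<and> reg s' x = Suc k \<and> I (Suc k) s') s"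
      unfolding wp_Seq wp_Assign
      by (rule wp_mono) (use 2 N one in \<open>auto simp: fun_upd_def\<close>)
    with guard[of k s] 2 N one show ?case by (auto simp: fun_upd_def)
  next
    case (3 s)
    with guard[of N s] N show ?case by auto
  next
    case (4 t s')
    have "(\<Sum>k<N. T k + 4 + (expr_cost (Op Less (Reg x) e) + 1)) = (\<Sum>k<N. T k + (expr_cost e + 7))"
      by (intro sum.cong) auto
    with 4 show ?case
      by (intro post) (auto)
  qed
qed

section \<open>Functions linear for exclusive or\<close>

lemma xor_lt:
  fixes a b :: nat
  assumes "a < 2 ^ k" "b < 2 ^ k"
  shows "a XOR b < 2 ^ k"
  using assms by (simp flip: take_bit_nat_eq_self_iff)

lemma xor_eq_0_iff: "a XOR b = 0 \<longleftrightarrow> a = b" for a b :: nat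
  by (metis xor.left_neutral xor.assoc xor.commute xor_self_eq)

lemma xor_cancel: "a XOR (a XOR b) = b" for a b :: nat
  by (simp flip: xor.assoc)

text \<open>Bit \<open>i\<close> of \<open>y\<close> is clear, so the addition produces no carry.
  This turns the offsets used for array positions into the group operation.\<close>

lemma pow_add_eq_xor:
  fixes y :: nat
  assumes "y < 2 ^ i"
  shows "2 ^ i + y = 2 ^ i XOR y"
proof (rule disjunctive_add_eq_xor)
  have "y = take_bit i y" using assms by (simp add: take_bit_nat_eq_self)
  then have "\<not> bit y i" by (metis bit_take_bit_iff less_irrefl)
  then show "2 ^ i AND y = 0"
    by (intro bit_eqI) (auto simp: bit_simps)
qed

lemma pow_add_xor:
  fixes x y :: nat
  assumes "x < 2 ^ i" "y < 2 ^ i"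
  shows "(2 ^ i + x) XOR y = 2 ^ i + (x XOR y)"
    and "x XOR (2 ^ i + y) = 2 ^ i + (x XOR y)"
    and "(2 ^ i + x) XOR (2 ^ i + y) = x XOR y"
  using assms by (simp_all add: pow_add_eq_xor xor_lt xor.assoc xor.left_commute)
    (metis xor.left_commute xor.left_neutral xor.right_neutral xor_self_eq)+

text \<open>Linearity over the field with two elements, numbers being read as bit vectors. The bound
  \<open>h\<close> is always a power of 2, so that \<open>{..<h}\<close> is closed under exclusive
  or.\<close>

definition linear_upto :: "nat \<Rightarrow> nat \<Rightarrow> (nat \<Rightarrow> nat) \<Rightarrow> bool" where
  "linear_upto h r F \<longleftrightarrow> (\<forall>x<h. F x < 2 ^ r) \<and> (\<forall>x<h. \<forall>y<h. F (x XOR y) = F x XOR F y)"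

lemma linear_upto_1: "F 0 = 0 \<Longrightarrow> linear_upto 1 r F"
  by (simp add: linear_upto_def)

text \<open>A linear map extends to one more dimension with an arbitrary image \<open>b\<close> of
  the new basis vector \<open>2 ^ i\<close>.\<close>

lemma linear_upto_double:
  assumes lin: "linear_upto (2 ^ i) r F" and b: "b < 2 ^ r"
    and lo: "\<And>y. y < 2 ^ i \<Longrightarrow> G y = F y" and hi: "\<And>y. y < 2 ^ i \<Longrightarrow> G (2 ^ i + y) = F y XOR b"
  shows "linear_upto (2 ^ Suc i) r G"
proof -
  have split: "x < 2 ^ i \<or> (\<exists>y < 2 ^ i. x = 2 ^ i + y)" if "x < 2 ^ Suc i" for x :: nat
  proof (cases "x < 2 ^ i")
    case False
    then show ?thesis using that by (intro disjI2 exI[of _ "x - 2 ^ i"]) auto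
  qed simp
  have r: "F x < 2 ^ r" if "x < 2 ^ i" for x using lin that by (simp add: linear_upto_def)
  have l: "F (x XOR y) = F x XOR F y" if "x < 2 ^ i" "y < 2 ^ i" for x y
    using lin that by (simp add: linear_upto_def)
  have "G x < 2 ^ r" if "x < 2 ^ Suc i" for x
    using split[OF that] by (auto simp: lo hi r b xor_lt)
  \<comment> \<open>Four cases according to the halves containing \<open>x\<close> and
    \<open>y\<close>; if both lie in the upper half, the two copies of \<open>b\<close>
    cancel.\<close>
  moreover have "G (x XOR y) = G x XOR G y" if "x < 2 ^ Suc i" "y < 2 ^ Suc i" for x y
    using split[OF that(1)] split[OF that(2)]
    by (auto simp: lo hi l xor_lt pow_add_xor xor_cancel xor.assoc xor.left_commute xor.commute)
  ultimately show ?thesis by (simp add: linear_upto_def)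
qed

section \<open>The scheme of a list of linear functions\<close>

text \<open>The number \<open>z < q * q\<close> encodes the pair of values
  \<open>(z div q, z mod q)\<close>, so one loop over \<open>z\<close> runs through all
  pairs.\<close>

definition query :: "nat list \<Rightarrow> nat \<Rightarrow> (nat \<Rightarrow> nat) \<Rightarrow> nat \<Rightarrow> nat set" where
  "query vs q F z = {vs ! x |x. x < length vs \<and> (F x = z div q \<or> F x = z mod q)}"

definition queries :: "nat list \<Rightarrow> nat \<Rightarrow> (nat \<Rightarrow> nat) list \<Rightarrow> nat set list" where
  "queries vs q Fs = concat (map (\<lambda>F. map (query vs q F) [0..<q * q]) Fs)"

definition zeros :: "(nat \<Rightarrow> nat) list \<Rightarrow> nat \<Rightarrow> nat" where
  "zeros Fs d = length (filter (\<lambda>F. F d = 0) Fs)"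

lemma length_queries: "length (queries vs q Fs) = length Fs * (q * q)"
  by (induction Fs) (simp_all add: queries_def)

lemma queries_snoc: "queries vs q (Fs @ [F]) = queries vs q Fs @ map (query vs q F) [0..<q * q]"
  by (simp add: queries_def)

lemma set_queries: "set (queries vs q Fs) = (\<Union>F\<in>set Fs. query vs q F ` {..<q * q})"
  by (auto simp: queries_def)

text \<open>Each of the \<open>2 * p\<close> pairs of a member of \<open>E\<close> and a member of
  \<open>W\<close> collides under at most \<open>Z\<close> functions, so by \<open>many\<close> some
  function separates all of them. Its values at \<open>u\<close> and \<open>v\<close> then select
  the query.\<close>

lemma queries_query_scheme:
  assumes lin: "\<forall>F\<in>set Fs. linear_upto (2 ^ K) r F"
    and dvs: "distinct vs" and n: "length vs \<le> 2 ^ K"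
    and zeros: "\<And>d. 0 < d \<Longrightarrow> d < 2 ^ K \<Longrightarrow> zeros Fs d \<le> Z"
    and many: "2 * p * Z < length Fs"
  shows "query_scheme (set vs) p (queries vs (2 ^ r) Fs)"
proof -
  have "\<exists>i < length (queries vs (2 ^ r) Fs).
      E \<subseteq> queries vs (2 ^ r) Fs ! i \<and> W \<inter> queries vs (2 ^ r) Fs ! i = {}"
    if "witness (set vs) p E W" for E W
  proof -
    from that obtain u v ws where E: "E = {u, v}" and W: "W = set ws" "length ws = p"
      and dist: "distinct (u # v # ws)" and sub: "set (u # v # ws) \<subseteq> set vs"
      unfolding witness_def by blast
    define ix where "ix a = (SOME i. i < length vs \<and> vs ! i = a)" for a
    have ix: "ix a < length vs" "vs ! ix a = a" if "a \<in> set vs" for a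
      using someI_ex[of "\<lambda>i. i < length vs \<and> vs ! i = a"] that
      unfolding ix_def in_set_conv_nth by blast+
    \<comment> \<open>Positions in \<open>Fs\<close> are counted, not functions, so repetitions in
      the list do no harm.\<close>
    define bad where "bad a b = {j. j < length Fs \<and> (Fs ! j) (ix a) = (Fs ! j) (ix b)}" for a b
    have card_bad: "card (bad a b) \<le> Z" if "a \<in> set vs" "b \<in> set vs" "a \<noteq> b" for a b
    proof -
      have "ix a \<noteq> ix b" using ix that by metis
      moreover have lt: "ix a < 2 ^ K" "ix b < 2 ^ K" using ix that n by (meson order_less_le_trans)+
      ultimately have "zeros Fs (ix a XOR ix b) \<le> Z"
        by (intro zeros xor_lt) (simp_all add: xor_eq_0_iff flip: neq0_conv)
      moreover have "bad a b = {j. j < length Fs \<and> (Fs ! j) (ix a XOR ix b) = 0}"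
      proof -
        have "(Fs ! j) (ix a XOR ix b) = (Fs ! j) (ix a) XOR (Fs ! j) (ix b)"
          if "j < length Fs" for j
          using lin lt nth_mem[OF that] unfolding linear_upto_def by blast
        then show ?thesis by (auto simp: bad_def xor_eq_0_iff)
      qed
      ultimately show ?thesis by (simp add: zeros_def length_filter_conv_card)
    qed
    define B where "B = (\<Union>x\<in>set ws. bad u x \<union> bad v x)"
    have "card B \<le> (\<Sum>x\<in>set ws. card (bad u x \<union> bad v x))"
      unfolding B_def by (rule card_UN_le) simp
    also have "\<dots> \<le> (\<Sum>x\<in>set ws. 2 * Z)"
    proof (rule sum_mono)
      fix x assume x: "x \<in> set ws"
      have "card (bad u x \<union> bad v x) \<le> card (bad u x) + card (bad v x)" by (rule card_Un_le)
      also have "\<dots> \<le> Z + Z" using x dist sub by (intro add_mono card_bad) auto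
      finally show "card (bad u x \<union> bad v x) \<le> 2 * Z" by simp
    qed
    also have "\<dots> = 2 * p * Z" using W dist by (simp add: distinct_card)
    finally have "card B < length Fs" using many by linarith
    moreover have "finite B" by (simp add: B_def bad_def)
    ultimately obtain j where j: "j < length Fs" "j \<notin> B"
      by (metis card_lessThan card_mono lessThan_iff not_le subsetI)
    define F where "F = Fs ! j"
    have F: "F \<in> set Fs" using j by (simp add: F_def)
    define q where "q = (2::nat) ^ r"
    have q: "0 < q" by (simp add: q_def)
    have Flt: "F (ix a) < q" if "a \<in> set vs" for a
    proof -
      have "ix a < 2 ^ K" using ix[OF that] n by (meson order_less_le_trans)
      then show ?thesis using lin F by (simp add: linear_upto_def q_def)
    qed
    \<comment> \<open>The code of the pair of values at \<open>u\<close> and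
      \<open>v\<close>.\<close>
    define z where "z = F (ix u) * q + F (ix v)"
    have z: "z div q = F (ix u)" "z mod q = F (ix v)"
      using Flt[of v] sub by (simp_all add: z_def)
    have "z < q * q"
    proof -
      have "z < F (ix u) * q + q" using Flt[of v] sub by (simp add: z_def)
      also have "\<dots> = Suc (F (ix u)) * q" by simp
      also have "\<dots> \<le> q * q" using Flt[of u] sub by (intro mult_le_mono1) auto
      finally show ?thesis .
    qed
    then have "query vs q F z \<in> set (queries vs q Fs)" using F by (auto simp: set_queries)
    moreover have "E \<subseteq> query vs q F z"
      using ix[of u] ix[of v] sub by (force simp: E query_def z)
    moreover have "W \<inter> query vs q F z = {}"
    proof -
      \<comment> \<open>A member of \<open>W\<close> inside the query would agree with
        \<open>u\<close> or \<open>v\<close> under \<open>F\<close>, which makes \<open>j\<close> a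
        bad position.\<close>
      have False if x: "x < length vs" "vs ! x \<in> set ws" "F x = F (ix u) \<or> F x = F (ix v)"
        for x
      proof -
        have "vs ! x \<in> set vs" using x by simp
        with ix[of "vs ! x"] dvs x(1) have "ix (vs ! x) = x"
          by (simp add: nth_eq_iff_index_eq)
        with x j have "j \<in> B" by (auto simp: B_def bad_def F_def)
        with j show False by simp
      qed
      then show ?thesis by (auto simp: W query_def z)
    qed
    ultimately show ?thesis
      unfolding q_def by (metis in_set_conv_nth)
  qed
  moreover have "\<forall>i < length (queries vs (2 ^ r) Fs). queries vs (2 ^ r) Fs ! i \<subseteq> set vs"
  proof -
    have "A \<subseteq> set vs" if "A \<in> set (queries vs (2 ^ r) Fs)" for A
      using that by (auto simp: set_queries query_def)
    then show ?thesis by simp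
  qed
  ultimately show ?thesis by (simp add: query_scheme_def)
qed


section \<open>Greedy choice of one linear function\<close>

text \<open>Frame condition: \<open>R\<close> and \<open>A\<close> bound the registers and arrays
  that may have changed.\<close>

definition same :: "string set \<Rightarrow> string set \<Rightarrow> state \<Rightarrow> state \<Rightarrow> bool" where
  "same R A s s' \<longleftrightarrow> (\<forall>x. x \<notin> R \<longrightarrow> reg s' x = reg s x) \<and> (\<forall>a. a \<notin> A \<longrightarrow> arr s' a = arr s a)"

lemma same_trans:
  "same R A s s' \<Longrightarrow> same R' A' s' s'' \<Longrightarrow> R \<subseteq> S \<Longrightarrow> R' \<subseteq> S \<Longrightarrow> A \<subseteq> B \<Longrightarrow> A' \<subseteq> B \<Longrightarrow> same S B s s''"
  unfolding same_def by (metis subsetD)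

lemma same_reg: "same R A s s' \<Longrightarrow> x \<notin> R \<Longrightarrow> reg s' x = reg s x"
  and same_arr: "same R A s s' \<Longrightarrow> a \<notin> A \<Longrightarrow> arr s' a = arr s a"
  by (simp_all add: same_def)

definition clear_buckets :: com where
  "clear_buckets = For ''a'' (Reg ''q'') (Store ''B'' (Reg ''a'') (Const 0))"

lemma wp_clear_buckets:
  assumes "reg s ''q'' = q" "q < 2 ^ w"
    and "\<And>t s'. t \<le> 11 * q + 6 \<Longrightarrow> same {''a''} {''B''} s s' \<Longrightarrow> \<forall>a<q. arr s' ''B'' a = 0 \<Longrightarrow> Q t s'"
  shows "wp w clear_buckets Q s"
  unfolding clear_buckets_def
  by (rule wp_For[where N = q and T = "\<lambda>_. 3"
        and I = "\<lambda>k s'. same {''a''} {''B''} s s' \<and> (\<forall>a<k. arr s' ''B'' a = 0)"])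
    (use assms in \<open>auto simp: wp_simps same_def less_Suc_eq\<close>)

text \<open>Bucket \<open>a\<close> collects the weight of the differences \<open>h + y\<close> at
  which the function would vanish if its value at \<open>h\<close> were \<open>a\<close>, since
  \<open>F y XOR a = 0\<close> iff \<open>F y = a\<close>.\<close>

definition fill_buckets :: com where
  "fill_buckets = For ''y'' (Reg ''h'')
     (Store ''B'' (Read ''F'' (Reg ''y''))
       (Op Plus (Read ''B'' (Read ''F'' (Reg ''y'')))
                (Read ''wt'' (Op Plus (Reg ''h'') (Reg ''y'')))))"

lemma wp_fill_buckets:
  assumes s: "reg s ''h'' = h" "2 * h < 2 ^ w" "q < 2 ^ w" "\<forall>y<h. arr s ''F'' y < q"
    "\<forall>a<q. arr s ''B'' a = 0" "(\<Sum>y<h. arr s ''wt'' (h + y)) < 2 ^ w"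
    and post: "\<And>t s'. t \<le> 19 * h + 6 \<Longrightarrow> same {''y''} {''B''} s s' \<Longrightarrow>
      \<forall>a<q. arr s' ''B'' a = (\<Sum>y<h. if arr s ''F'' y = a then arr s ''wt'' (h + y) else 0) \<Longrightarrow> Q t s'"
  shows "wp w fill_buckets Q s"
  unfolding fill_buckets_def
proof (rule wp_For[where N = h and T = "\<lambda>_. 11" and I = "\<lambda>k s'. same {''y''} {''B''} s s' \<and>
    (\<forall>a<q. arr s' ''B'' a = (\<Sum>y<k. if arr s ''F'' y = a then arr s ''wt'' (h + y) else 0))"], goal_cases)
  case (4 k s')
  \<comment> \<open>No overflow: a bucket never exceeds the total weight of the upper half.\<close>
  have "(\<Sum>y<k. if arr s ''F'' y = arr s ''F'' k then arr s ''wt'' (h + y) else 0) + arr s ''wt'' (h + k)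
      \<le> (\<Sum>y<k. arr s ''wt'' (h + y)) + arr s ''wt'' (h + k)"
    by (intro add_mono sum_mono) auto
  also have "\<dots> = (\<Sum>y<Suc k. arr s ''wt'' (h + y))" by simp
  also have "\<dots> \<le> (\<Sum>y<h. arr s ''wt'' (h + y))" using 4 by (intro sum_mono2) auto
  finally have *: "(\<Sum>y<k. if arr s ''F'' y = arr s ''F'' k then arr s ''wt'' (h + y) else 0)
      + arr s ''wt'' (h + k) < 2 ^ w" using s by linarith
  have "arr s ''F'' k < q" using 4 s by auto
  with 4 s * show ?case by (auto simp: wp_simps same_def)
qed (use s post in \<open>auto simp: same_def\<close>)

definition lightest_bucket :: com where
  "lightest_bucket = Seq (Assign ''b'' (Const 0)) (For ''a'' (Reg ''q'')
     (Cond (Op Less (Read ''B'' (Reg ''a'')) (Read ''B'' (Reg ''b'')))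
       (Assign ''b'' (Reg ''a'')) Skip))"

lemma wp_lightest_bucket:
  assumes s: "reg s ''q'' = q" "0 < q" "q < 2 ^ w" "\<forall>a<q. arr s ''B'' a < 2 ^ w"
    and post: "\<And>t s'. t \<le> 16 * q + 8 \<Longrightarrow> same {''a'', ''b''} {} s s' \<Longrightarrow> reg s' ''b'' < q \<Longrightarrow>
      \<forall>a<q. arr s ''B'' (reg s' ''b'') \<le> arr s ''B'' a \<Longrightarrow> Q t s'"
  shows "wp w lightest_bucket Q s"
  unfolding lightest_bucket_def wp_Seq wp_Assign
proof (intro conjI, simp, rule wp_For[where N = q and T = "\<lambda>_. 8" and I = "\<lambda>k s'. same {''a'', ''b''} {} s s' \<and>
    reg s' ''b'' < q \<and> (\<forall>a<k. arr s ''B'' (reg s' ''b'') \<le> arr s ''B'' a)"], goal_cases)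
  case (4 k s')
  have B: "arr s' ''B'' = arr s ''B''" "reg s' ''q'' = q" using 4 s by (auto simp: same_def)
  with 4 s B show ?case
    by (auto simp: wp_simps same_def less_Suc_eq not_less dest: order.strict_trans2 less_imp_le)
qed (use s post in \<open>auto simp: same_def\<close>)

text \<open>The machine has no exclusive or, so \<open>F y XOR b\<close> is looked up in the table
  \<open>X\<close> at the code of the pair. New zeros double their weight in the same pass.\<close>

definition extend_code :: com where
  "extend_code = For ''y'' (Reg ''h'') (Seq
     (Store ''F'' (Op Plus (Reg ''h'') (Reg ''y''))
       (Read ''X'' (Op Plus (Op Times (Read ''F'' (Reg ''y'')) (Reg ''q'')) (Reg ''b''))))
     (Cond (Op Equal (Read ''F'' (Op Plus (Reg ''h'') (Reg ''y''))) (Const 0))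
       (Store ''wt'' (Op Plus (Reg ''h'') (Reg ''y''))
         (Op Times (Const 2) (Read ''wt'' (Op Plus (Reg ''h'') (Reg ''y'')))))
       Skip))"

definition is_xor_table :: "nat \<Rightarrow> (nat \<Rightarrow> nat) \<Rightarrow> bool" where
  "is_xor_table q X \<longleftrightarrow> (\<forall>z<q * q. X z = (z div q) XOR (z mod q))"

lemma pair_index_less:
  fixes x y q :: nat
  assumes "x < q" "y < q"
  shows "x * q + y < q * q"
proof -
  have "x * q + y < Suc x * q" using assms by simp
  also have "\<dots> \<le> q * q" using assms by (intro mult_le_mono1) auto
  finally show ?thesis .
qed

lemma is_xor_tableD: "is_xor_table q X \<Longrightarrow> x < q \<Longrightarrow> y < q \<Longrightarrow> X (x * q + y) = x XOR y"
  by (simp add: is_xor_table_def pair_index_less)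

lemma wp_extend_code:
  assumes s: "reg s ''h'' = h" "reg s ''q'' = 2 ^ r" "reg s ''b'' = b" "b < 2 ^ r"
    "2 < (2::nat) ^ w" "2 * h < 2 ^ w" "2 ^ r * 2 ^ r < (2::nat) ^ w" "\<forall>y<h. arr s ''F'' y < 2 ^ r"
    "\<forall>y<h. 2 * arr s ''wt'' (h + y) < 2 ^ w" "is_xor_table (2 ^ r) (arr s ''X'')"
    and post: "\<And>t s'. t \<le> 36 * h + 6 \<Longrightarrow> same {''y''} {''F'', ''wt''} s s' \<Longrightarrow>
      arr s' ''F'' = (\<lambda>x. if h \<le> x \<and> x < h + h then arr s ''F'' (x - h) XOR b else arr s ''F'' x) \<Longrightarrow>
      arr s' ''wt'' = (\<lambda>x. if h \<le> x \<and> x < h + h \<and> arr s ''F'' (x - h) = b then 2 * arr s ''wt'' x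
        else arr s ''wt'' x) \<Longrightarrow> Q t s'"
  shows "wp w extend_code Q s"
  unfolding extend_code_def
proof (rule wp_For[where N = h and T = "\<lambda>_. 28" and I = "\<lambda>k s'. same {''y''} {''F'', ''wt''} s s' \<and>
      arr s' ''F'' = (\<lambda>x. if h \<le> x \<and> x < h + k then arr s ''F'' (x - h) XOR b else arr s ''F'' x) \<and>
      arr s' ''wt'' = (\<lambda>x. if h \<le> x \<and> x < h + k \<and> arr s ''F'' (x - h) = b then 2 * arr s ''wt'' x
        else arr s ''wt'' x)"], goal_cases)
  case (4 k s')
  have r: "reg s' ''h'' = h" "reg s' ''q'' = 2 ^ r" "reg s' ''b'' = b" "arr s' ''X'' = arr s ''X''"
    using 4 s by (auto simp: same_def)
  let ?f = "arr s ''F'' k"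
  have f: "?f < 2 ^ r" using 4 s by auto
  have lt: "?f * 2 ^ r + b < 2 ^ r * 2 ^ r" using f s(4) by (rule pair_index_less)
  then have lt': "?f * 2 ^ r + b < 2 ^ w" "?f * 2 ^ r < 2 ^ w" using s by linarith+
  have X: "arr s ''X'' (?f * 2 ^ r + b) = ?f XOR b" using s f by (intro is_xor_tableD)
  have rw: "(2::nat) ^ r < 2 ^ w" using s(7) le_square[of "2 ^ r"] by linarith
  have xw: "?f XOR b < 2 ^ w" using xor_lt[OF f s(4)] rw by linarith
  \<comment> \<open>Earlier rounds wrote only to positions from \<open>h\<close> to
    \<open>h + k - 1\<close>, so the cells read now still hold their original contents.\<close>
  have F: "arr s' ''F'' k = ?f" and wt: "arr s' ''wt'' (h + k) = arr s ''wt'' (h + k)"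
    and k: "reg s' ''y'' = k" "h + k < 2 ^ w" "k < 2 ^ w" "h < 2 ^ w"
    and wtw: "2 * arr s ''wt'' (h + k) < 2 ^ w" "arr s ''wt'' (h + k) < 2 ^ w"
    using 4 s rw by auto
  have fw: "?f < 2 ^ w" "b < 2 ^ w" using f s(4) rw by linarith+
  have one: "1 < (2::nat) ^ w" "0 < (2::nat) ^ w" using s(5) by linarith+
  have sm: "same {''y''} {''F'', ''wt''} s s'" using 4 by blast
  have xf: "?f XOR b = 0 \<longleftrightarrow> ?f = b" by (rule xor_eq_0_iff)
  have eqs: "(arr s' ''F'')(h + k := ?f XOR b) =
      (\<lambda>x. if h \<le> x \<and> x < h + Suc k then arr s ''F'' (x - h) XOR b else arr s ''F'' x)"
    "?f = b \<Longrightarrow> (arr s' ''wt'')(h + k := 2 * arr s ''wt'' (h + k)) = (\<lambda>x. if h \<le> x \<and> x < h + Suc k \<and>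
        arr s ''F'' (x - h) = b then 2 * arr s ''wt'' x else arr s ''wt'' x)"
    "?f \<noteq> b \<Longrightarrow> arr s' ''wt'' = (\<lambda>x. if h \<le> x \<and> x < h + Suc k \<and>
        arr s ''F'' (x - h) = b then 2 * arr s ''wt'' x else arr s ''wt'' x)"
    using 4 by (auto simp: fun_eq_iff less_Suc_eq)
  show ?case
    using sm s(4,5) eqs
    by (simp add: wp_simps r F wt k wtw fw lt' X xw rw one xf) (simp add: same_def)
qed (use s post in \<open>auto simp: same_def fun_eq_iff\<close>)


text \<open>What the first \<open>i\<close> levels achieve: the second conjunct says that exactly the zeros of \<open>F\<close> have
  doubled their weight, the third that the greedy choice beats the average.\<close>

definition built :: "nat \<Rightarrow> nat \<Rightarrow> (nat \<Rightarrow> nat) \<Rightarrow> (nat \<Rightarrow> nat) \<Rightarrow> (nat \<Rightarrow> nat) \<Rightarrow> bool" where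
  "built i r wt0 F wt \<longleftrightarrow> linear_upto (2 ^ i) r F \<and>
     (\<forall>x. wt x = (if 0 < x \<and> x < 2 ^ i \<and> F x = 0 then 2 * wt0 x else wt0 x)) \<and>
     2 ^ r * (\<Sum>x\<in>{0<..<2 ^ i}. wt x) \<le> (2 ^ r + 1) * (\<Sum>x\<in>{0<..<2 ^ i}. wt0 x)"

lemma built_0: "F 0 = 0 \<Longrightarrow> built 0 r wt F wt"
  by (auto simp: built_def intro: linear_upto_1[simplified])

text \<open>The buckets partition \<open>{..<h}\<close>, so their \<open>q\<close> weights add up to
  the whole sum, and the least of them is at most the average.\<close>

lemma lightest_bucket_average:
  fixes g :: "nat \<Rightarrow> nat"
  assumes F: "\<forall>y<h. F y < q"
    and min: "\<forall>a<q. (\<Sum>y<h. if F y = b then g y else 0) \<le> (\<Sum>y<h. if F y = a then g y else 0)"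
  shows "q * (\<Sum>y<h. if F y = b then g y else 0) \<le> (\<Sum>y<h. g y)"
proof -
  have "q * (\<Sum>y<h. if F y = b then g y else 0) \<le> (\<Sum>a<q. \<Sum>y<h. if F y = a then g y else 0)"
    using sum_bounded_below[of "{..<q}" "\<Sum>y<h. if F y = b then g y else 0"] min by simp
  also have "\<dots> = (\<Sum>y<h. \<Sum>a<q. if F y = a then g y else 0)" by (rule sum.swap)
  also have "\<dots> = (\<Sum>y<h. g y)" using F by (intro sum.cong) auto
  finally show ?thesis .
qed

text \<open>Weight sums omit 0, where every linear function vanishes; the omitted point belongs to
  the lower half.\<close>

lemma sum_split_pow:
  fixes g :: "nat \<Rightarrow> nat"
  assumes "0 < h"
  shows "(\<Sum>x\<in>{0<..<h + h}. g x) = (\<Sum>x\<in>{0<..<h}. g x) + (\<Sum>y<h. g (h + y))"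
proof -
  have "(\<lambda>y. h + y) ` {..<h} = {h..<h + h}"
    by (simp add: lessThan_atLeast0)
  then have "(\<Sum>y<h. g (h + y)) = (\<Sum>x\<in>{h..<h + h}. g x)"
    by (metis (no_types, lifting) inj_on_add sum.reindex_cong)
  moreover have "{0<..<h + h} = {0<..<h} \<union> {h..<h + h}" "{0<..<h} \<inter> {h..<h + h} = {}"
    using assms by auto
  ultimately show ?thesis
    by (simp add: sum.union_disjoint)
qed

text \<open>The lower half keeps its weights, so the old inequality covers it. On the upper half the
  weights are still \<open>wt0\<close>, and doubling the lightest bucket adds at most a fraction
  \<open>1 / q\<close> of their sum. Adding the two inequalities gives the new one.\<close>

lemma built_Suc:
  assumes bt: "built i r wt0 F wt" and b: "b < 2 ^ r"
    and min: "\<forall>a<2 ^ r. (\<Sum>y<2 ^ i. if F y = b then wt (2 ^ i + y) else 0)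
      \<le> (\<Sum>y<2 ^ i. if F y = a then wt (2 ^ i + y) else 0)"
    and G: "G = (\<lambda>x. if 2 ^ i \<le> x \<and> x < 2 ^ i + 2 ^ i then F (x - 2 ^ i) XOR b else F x)"
    and wt': "wt' = (\<lambda>x. if 2 ^ i \<le> x \<and> x < 2 ^ i + 2 ^ i \<and> F (x - 2 ^ i) = b then 2 * wt x else wt x)"
  shows "built (Suc i) r wt0 G wt'"
proof -
  define h where "h = (2::nat) ^ i"
  have h: "0 < h" "2 ^ Suc i = h + h" by (simp_all add: h_def)
  note bt' = bt[unfolded built_def, folded h_def]
  have hi: "wt x = wt0 x" if "h \<le> x" for x using bt' that by simp
  have lin: "linear_upto (2 ^ Suc i) r G"
    by (rule linear_upto_double[OF _ b, of i F]) (use bt in \<open>auto simp: G built_def\<close>)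
  have eq: "wt' x = (if 0 < x \<and> x < h + h \<and> G x = 0 then 2 * wt0 x else wt0 x)" for x
    using bt' h(1) by (auto simp: wt' G xor_eq_0_iff simp flip: h_def)
  have "q * (\<Sum>y<h. wt' (h + y)) \<le> (q + 1) * (\<Sum>y<h. wt0 (h + y))" if "q = 2 ^ r" for q
  proof -
    have "(\<Sum>y<h. wt' (h + y)) = (\<Sum>y<h. wt0 (h + y) + (if F y = b then wt0 (h + y) else 0))"
      by (intro sum.cong) (auto simp: wt' hi simp flip: h_def)
    also have "\<dots> = (\<Sum>y<h. wt0 (h + y)) + (\<Sum>y<h. if F y = b then wt0 (h + y) else 0)"
      by (rule sum.distrib)
    finally have "(\<Sum>y<h. wt' (h + y)) = \<dots>" .
    moreover have "q * (\<Sum>y<h. if F y = b then wt0 (h + y) else 0) \<le> (\<Sum>y<h. wt0 (h + y))"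
      using min[folded h_def] bt' that
      by (intro lightest_bucket_average) (auto simp: hi linear_upto_def cong: if_cong)
    ultimately show ?thesis by (simp add: algebra_simps)
  qed
  moreover have "(\<Sum>x\<in>{0<..<h}. wt' x) = (\<Sum>x\<in>{0<..<h}. wt x)"
    by (intro sum.cong) (auto simp: wt' simp flip: h_def)
  ultimately have "2 ^ r * (\<Sum>x\<in>{0<..<h + h}. wt' x) \<le> (2 ^ r + 1) * (\<Sum>x\<in>{0<..<h + h}. wt0 x)"
    using bt' unfolding sum_split_pow[OF h(1)] add_mult_distrib2 by (metis add_mono)
  with lin eq show ?thesis unfolding built_def h(2) by blast
qed

definition level :: com where
  "level = Seq clear_buckets (Seq fill_buckets (Seq lightest_bucket (Seq extend_code
     (Assign ''h'' (Op Times (Const 2) (Reg ''h''))))))"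

text \<open>The factor 2 in the bound on the weights leaves room for the doubling of any single one.
  In the running time, \<open>27 = 11 + 16\<close> collects the two passes over the buckets and
  \<open>55 = 19 + 36\<close> the two passes over the lower half.\<close>

lemma wp_level:
  assumes s: "reg s ''h'' = 2 ^ i" "reg s ''q'' = 2 ^ r" "is_xor_table (2 ^ r) (arr s ''X'')"
    and w: "2 < (2::nat) ^ w" "2 * 2 ^ i < (2::nat) ^ w" "2 ^ r * 2 ^ r < (2::nat) ^ w"
      "2 * (\<Sum>x\<in>{0<..<2 ^ Suc i}. wt0 x) < 2 ^ w"
    and built: "built i r wt0 (arr s ''F'') (arr s ''wt'')"
    and post: "\<And>t s'. t \<le> 27 * 2 ^ r + 55 * 2 ^ i + 30 \<Longrightarrow>
      same {''a'', ''y'', ''b'', ''h''} {''B'', ''F'', ''wt''} s s' \<Longrightarrow> reg s' ''h'' = 2 ^ Suc i \<Longrightarrow>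
      built (Suc i) r wt0 (arr s' ''F'') (arr s' ''wt'') \<Longrightarrow> Q t s'"
  shows "wp w level Q s"
proof -
  define q where "q = (2::nat) ^ r"
  define h where "h = (2::nat) ^ i"
  have q: "0 < q" "q < 2 ^ w" using w(3) le_square[of q] unfolding q_def by (simp, linarith)
  have h: "0 < h" "2 * h < 2 ^ w" "h < 2 ^ w" using w(2) unfolding h_def by (simp, linarith+)
  let ?F = "arr s ''F''" and ?wt = "arr s ''wt''"
  have F: "\<forall>y<h. ?F y < q" using built by (simp add: built_def linear_upto_def h_def q_def)
  have wt: "?wt (h + y) = wt0 (h + y)" for y using built by (simp add: built_def h_def)
  have "(\<Sum>y<h. ?wt (h + y)) \<le> (\<Sum>x\<in>{0<..<2 ^ Suc i}. wt0 x)"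
    using sum_split_pow[OF h(1), of wt0] by (simp add: wt mult_2 flip: h_def)
  then have S: "2 * (\<Sum>y<h. ?wt (h + y)) < 2 ^ w" using w(4) by linarith
  have S1: "2 * ?wt (h + y) < 2 ^ w" if "y < h" for y
    using member_le_sum[of y "{..<h}" "\<lambda>y. ?wt (h + y)"] that S by simp
  have S2: "(\<Sum>y<h. if ?F y = a then ?wt (h + y) else 0) < 2 ^ w" for a
  proof -
    have "(\<Sum>y<h. if ?F y = a then ?wt (h + y) else 0) \<le> (\<Sum>y<h. ?wt (h + y))"
      by (intro sum_mono) auto
    with S show ?thesis by linarith
  qed
  show ?thesis
    unfolding level_def wp_Seq
  proof (rule wp_clear_buckets[where q = q], goal_cases)
    case (3 t1 s1)
    note s1 = same_reg[OF 3(2)] same_arr[OF 3(2)]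
    show ?case
    proof (rule wp_fill_buckets[where q = q and h = h], goal_cases)
      case (7 t2 s2)
      note s2 = same_reg[OF 7(2)] same_arr[OF 7(2)]
      show ?case
      proof (rule wp_lightest_bucket[where q = q], goal_cases)
        case (5 t3 s3)
        note s3 = same_reg[OF 5(2)] same_arr[OF 5(2)]
        show ?case
        proof (rule wp_extend_code[where r = r and h = h and b = "reg s3 ''b''"], goal_cases)
          case 5
          show ?case by (rule w(1))
        next
          case (11 t4 s4)
          note s4 = same_reg[OF 11(2)] same_arr[OF 11(2)]
          have b: "built (Suc i) r wt0 (arr s4 ''F'') (arr s4 ''wt'')"
            by (rule built_Suc[OF built, where b = "reg s3 ''b''"])
              (use 5(3,4) 7(3) 11(3,4) in \<open>simp_all add: s1 s2 s3 q_def h_def cong: if_cong\<close>)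
          have t: "t1 + (t2 + (t3 + (t4 + 4))) \<le> 27 * 2 ^ r + 55 * 2 ^ i + 30"
            using 3(1) 7(1) 5(1) 11(1) by (simp add: q_def h_def)
          have sm: "same {''a'', ''y'', ''b'', ''h''} {''B'', ''F'', ''wt''} s s4"
            using 3(2) 7(2) 5(2) 11(2) by (simp add: same_def)
          have r4: "reg s4 ''h'' = h" using s by (simp add: s1 s2 s3 s4 h_def)
          have fits: "expr_fits w (Op Times (Const 2) (Reg ''h'')) s4"
            using w(1) h r4 by simp
          let ?s = "s4\<lparr>reg := (reg s4)(''h'' := expr_val (Op Times (Const 2) (Reg ''h'')) s4)\<rparr>"
          have "same {''a'', ''y'', ''b'', ''h''} {''B'', ''F'', ''wt''} s ?s" "reg ?s ''h'' = 2 ^ Suc i"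
            using sm r4 by (simp_all add: same_def h_def)
          with fits t b show ?case
            unfolding wp_Assign by (intro conjI post) simp_all
        qed (use 5(3) w F h S1 s in \<open>simp_all add: s1 s2 s3 q_def h_def cong: if_cong\<close>)
      qed (use q s S2 7(3) in \<open>simp_all add: s1 s2 q_def cong: if_cong\<close>)
    qed (use 3(3) h q F S s in \<open>simp_all add: s1 h_def\<close>)
  qed (use q s in \<open>simp_all add: q_def\<close>)
qed

definition build_code :: com where
  "build_code = Seq (Assign ''h'' (Const 1)) (While (Op Less (Reg ''h'') (Reg ''N'')) level)"

text \<open>The cost of level \<open>i\<close> is linear in \<open>2 ^ r + 2 ^ i\<close>; the
  geometric sum keeps the part depending on \<open>2 ^ i\<close> linear in \<open>2 ^ K\<close>
  without a further factor \<open>K\<close>. Of the previous contents of \<open>F\<close> only the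
  value at 0 is kept, as level \<open>i\<close> rewrites the positions from \<open>2 ^ i\<close> up
  to \<open>2 ^ Suc i\<close>, exclusive.\<close>

lemma wp_build_code:
  assumes s: "reg s ''N'' = 2 ^ K" "reg s ''q'' = 2 ^ r" "is_xor_table (2 ^ r) (arr s ''X'')"
      "arr s ''F'' 0 = 0"
    and w: "2 < (2::nat) ^ w" "2 ^ K < (2::nat) ^ w" "2 ^ r * 2 ^ r < (2::nat) ^ w"
      "2 * (\<Sum>x\<in>{0<..<2 ^ K}. arr s ''wt'' x) < 2 ^ w"
    and post: "\<And>t s'. t \<le> 27 * 2 ^ r * K + 55 * 2 ^ K + 34 * K + 6 \<Longrightarrow>
      same {''a'', ''y'', ''b'', ''h''} {''B'', ''F'', ''wt''} s s' \<Longrightarrow>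
      built K r (arr s ''wt'') (arr s' ''F'') (arr s' ''wt'') \<Longrightarrow> Q t s'"
  shows "wp w build_code Q s"
  unfolding build_code_def wp_Seq wp_Assign
proof (intro conjI, use w in simp, rule wp_While[where N = K and T = "\<lambda>i. 27 * 2 ^ r + 55 * 2 ^ i + 30"
      and I = "\<lambda>i s'. same {''a'', ''y'', ''b'', ''h''} {''B'', ''F'', ''wt''} s s' \<and>
        reg s' ''h'' = 2 ^ i \<and> built i r (arr s ''wt'') (arr s' ''F'') (arr s' ''wt'')"], goal_cases)
  case 1
  show ?case using s by (simp add: same_def built_0)
next
  case (2 i s')
  note s' = same_reg[OF 2(2)[THEN conjunct1]] same_arr[OF 2(2)[THEN conjunct1]]
  have pow: "(2::nat) ^ Suc i \<le> 2 ^ K" using 2(1) by (intro power_increasing) auto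
  have "(\<Sum>x\<in>{0<..<2 ^ Suc i}. arr s ''wt'' x) \<le> (\<Sum>x\<in>{0<..<2 ^ K}. arr s ''wt'' x)"
    using pow by (intro sum_mono2) auto
  then have S: "2 * (\<Sum>x\<in>{0<..<2 ^ Suc i}. arr s ''wt'' x) < 2 ^ w" using w(4) by linarith
  have p: "2 * 2 ^ i < (2::nat) ^ w" "(2::nat) ^ i < 2 ^ w" using pow w(2) unfolding power_Suc by linarith+
  have "wp w level (\<lambda>t s'. t \<le> 27 * 2 ^ r + 55 * 2 ^ i + 30 \<and>
      same {''a'', ''y'', ''b'', ''h''} {''B'', ''F'', ''wt''} s s' \<and>
        reg s' ''h'' = 2 ^ Suc i \<and> built (Suc i) r (arr s ''wt'') (arr s' ''F'') (arr s' ''wt'')) s'"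
    by (rule wp_level[where i = i and r = r and ?wt0.0 = "arr s ''wt''"])
      (use 2(2) s w p S in \<open>auto simp: s' simp del: power_Suc elim: same_trans\<close>)
  with 2 p w s s' show ?case by (simp add: power_strict_increasing_iff)
next
  case (3 s')
  note s' = same_reg[OF 3[THEN conjunct1]]
  show ?case using 3 s w by (simp add: s')
next
  case (4 t s')
  have "(\<Sum>i<K. (2::nat) ^ i) \<le> 2 ^ K" for K
    by (induction K) auto
  from this[of K] have "(\<Sum>i<K. 27 * 2 ^ r + 55 * 2 ^ i + 30 + 4) \<le> 27 * 2 ^ r * K + 55 * 2 ^ K + 34 * K"
    by (simp add: sum.distrib flip: sum_distrib_left)
  with 4 show ?case by (intro post) auto
qed


section \<open>Writing the family and iterating\<close>

text \<open>The last two conjuncts are needed to extend the family: new elements are written beyond all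
  earlier sets, and the write position fits into a word.\<close>

definition outs :: "nat \<Rightarrow> state \<Rightarrow> nat set list \<Rightarrow> bool" where
  "outs n s Qs \<longleftrightarrow> outputs_family s Qs \<and> reg s ''o'' = arr s ''off'' (length Qs) \<and>
     (\<forall>i \<le> length Qs. arr s ''off'' i \<le> reg s ''o'') \<and> reg s ''o'' \<le> length Qs * n"

lemma outs_snoc:
  assumes "outs n s Qs" "reg s' ''size'' = Suc (length Qs)" "reg s ''o'' \<le> reg s' ''o''"
    "reg s' ''o'' \<le> reg s ''o'' + n"
    "\<forall>i<reg s ''o''. arr s' ''Q'' i = arr s ''Q'' i"
    "A = arr s' ''Q'' ` {reg s ''o''..<reg s' ''o''}"
    "arr s' ''off'' = (arr s ''off'')(Suc (length Qs) := reg s' ''o'')"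
  shows "outs n s' (Qs @ [A])"
proof -
  have "arr s' ''Q'' ` {arr s ''off'' i..<arr s ''off'' (i + 1)} =
      arr s ''Q'' ` {arr s ''off'' i..<arr s ''off'' (i + 1)}" if "i < length Qs" for i
  proof (rule image_cong[OF refl])
    fix x assume "x \<in> {arr s ''off'' i..<arr s ''off'' (i + 1)}"
    moreover have "arr s ''off'' (i + 1) \<le> reg s ''o''" using assms(1) that
      unfolding outs_def by (metis Suc_eq_plus1 Suc_leI)
    ultimately show "arr s' ''Q'' x = arr s ''Q'' x" using assms(5) by simp
  qed
  with assms show ?thesis
    by (auto simp: outs_def outputs_family_def nth_append less_Suc_eq le_Suc_eq)
qed

text \<open>The sum of two comparisons serves as disjunction. It equals 2 when both hold, so 2 has
  to fit into a word.\<close>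

definition write_query :: com where
  "write_query = For ''x'' (Reg ''n'') (Cond
     (Op Plus (Op Equal (Read ''F'' (Reg ''x'')) (Op Div (Reg ''z'') (Reg ''q'')))
              (Op Equal (Read ''F'' (Reg ''x'')) (Op Mod (Reg ''z'') (Reg ''q''))))
     (Seq (Store ''Q'' (Reg ''o'') (Read ''V'' (Reg ''x'')))
          (Assign ''o'' (Op Plus (Reg ''o'') (Const 1))))
     Skip)"

lemma wp_write_query:
  assumes s: "reg s ''n'' = length vs" "reg s ''z'' < 2 ^ w" "reg s ''q'' = q"
      "\<forall>x<length vs. arr s ''F'' x < q" "\<forall>x<length vs. arr s ''V'' x = vs ! x \<and> vs ! x < 2 ^ w"
    and w: "2 < (2::nat) ^ w" "q < 2 ^ w" "reg s ''o'' + length vs < 2 ^ w"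
    and post: "\<And>t s'. t \<le> 30 * length vs + 6 \<Longrightarrow> same {''x'', ''o''} {''Q''} s s' \<Longrightarrow>
      reg s ''o'' \<le> reg s' ''o'' \<Longrightarrow> reg s' ''o'' \<le> reg s ''o'' + length vs \<Longrightarrow>
      \<forall>i<reg s ''o''. arr s' ''Q'' i = arr s ''Q'' i \<Longrightarrow>
      arr s' ''Q'' ` {reg s ''o''..<reg s' ''o''} = query vs q (arr s ''F'') (reg s ''z'') \<Longrightarrow> Q t s'"
  shows "wp w write_query Q s"
  unfolding write_query_def
proof (rule wp_For[where N = "length vs" and T = "\<lambda>_. 22" and I = "\<lambda>k s'. same {''x'', ''o''} {''Q''} s s' \<and>
      reg s ''o'' \<le> reg s' ''o'' \<and> reg s' ''o'' \<le> reg s ''o'' + k \<and>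
      (\<forall>i<reg s ''o''. arr s' ''Q'' i = arr s ''Q'' i) \<and>
      arr s' ''Q'' ` {reg s ''o''..<reg s' ''o''} = {vs ! x |x. x < k \<and>
        (arr s ''F'' x = reg s ''z'' div q \<or> arr s ''F'' x = reg s ''z'' mod q)}"], goal_cases)
  case (4 k s')
  have s': "reg s' ''z'' = reg s ''z''" "reg s' ''q'' = q" "arr s' ''F'' = arr s ''F''" "arr s' ''V'' = arr s ''V''"
    using 4 s by (auto simp: same_def)
  have V: "arr s ''V'' k = vs ! k" "vs ! k < 2 ^ w" using s 4 by auto
  have F: "arr s ''F'' k < 2 ^ w" using s(4) 4(1) w(2) by (meson order.strict_trans)
  have lt: "reg s ''z'' div q < 2 ^ w" "reg s ''z'' mod q < 2 ^ w"
    using s by (meson div_le_dividend mod_less_eq_dividend le_less_trans)+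
  have o: "Suc (reg s' ''o'') < 2 ^ w" "reg s' ''o'' < 2 ^ w" "k < 2 ^ w" using 4 w by linarith+
  let ?hit = "arr s ''F'' k = reg s ''z'' div q \<or> arr s ''F'' k = reg s ''z'' mod q"
  have ivl: "{reg s ''o''..<Suc (reg s' ''o'')} = insert (reg s' ''o'') {reg s ''o''..<reg s' ''o''}"
    using 4 by auto
  define Q' where Q': "Q' = (arr s' ''Q'')(reg s' ''o'' := vs ! k)"
  have imgQ': "Q' ` {reg s ''o''..<Suc (reg s' ''o'')} =
      insert (vs ! k) (arr s' ''Q'' ` {reg s ''o''..<reg s' ''o''})"
  proof -
    have "Q' ` {reg s ''o''..<reg s' ''o''} = arr s' ''Q'' ` {reg s ''o''..<reg s' ''o''}"
      by (rule image_cong) (simp_all add: Q')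
    then show ?thesis unfolding ivl image_insert by (simp add: Q')
  qed
  have Q'old: "\<forall>i<reg s ''o''. Q' i = arr s ''Q'' i" using 4 by (simp add: Q')
  have eq: "{vs ! x |x. x < Suc k \<and> (arr s ''F'' x = reg s ''z'' div q \<or> arr s ''F'' x = reg s ''z'' mod q)} =
      (if ?hit then insert (vs ! k) else id) {vs ! x |x. x < k \<and>
        (arr s ''F'' x = reg s ''z'' div q \<or> arr s ''F'' x = reg s ''z'' mod q)}"
    by (auto simp: less_Suc_eq)
  have sm: "same {''x'', ''o''} {''Q''} s s'" and kx: "reg s' ''x'' = k"
    and ol: "reg s ''o'' \<le> reg s' ''o''" "reg s' ''o'' \<le> reg s ''o'' + k" "reg s' ''o'' \<le> Suc (reg s ''o'' + k)"
    and old: "\<forall>i<reg s ''o''. arr s' ''Q'' i = arr s ''Q'' i"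
    and im: "arr s' ''Q'' ` {reg s ''o''..<reg s' ''o''} = {vs ! x |x. x < k \<and>
        (arr s ''F'' x = reg s ''z'' div q \<or> arr s ''F'' x = reg s ''z'' mod q)}"
    using 4 by auto
  have one: "0 < (2::nat) ^ w" "1 < (2::nat) ^ w" "Suc 0 < (2::nat) ^ w" "Suc (Suc 0) < (2::nat) ^ w" using w(1) by linarith+
  have fits: "expr_fits w (Op Plus (Op Equal (Read ''F'' (Reg ''x'')) (Op Div (Reg ''z'') (Reg ''q'')))
              (Op Equal (Read ''F'' (Reg ''x'')) (Op Mod (Reg ''z'') (Reg ''q'')))) s'"
    using one by (simp add: s' kx V F lt o s w(2))
  show ?case
  proof (cases ?hit)
    case True
    have val: "expr_val (Op Plus (Op Equal (Read ''F'' (Reg ''x'')) (Op Div (Reg ''z'') (Reg ''q'')))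
              (Op Equal (Read ''F'' (Reg ''x'')) (Op Mod (Reg ''z'') (Reg ''q'')))) s' \<noteq> 0"
      using True by (auto simp: s' kx)
    let ?s = "s'\<lparr>arr := (arr s')(''Q'' := (arr s' ''Q'')(reg s' ''o'' := vs ! k)),
        reg := (reg s')(''o'' := Suc (reg s' ''o''))\<rparr>"
    have "same {''x'', ''o''} {''Q''} s (?s\<lparr>reg := (reg ?s)(''x'' := Suc k)\<rparr>)"
      using sm by (simp add: same_def)
    with True ol Q'old show ?thesis
      unfolding eq wp_Cond if_P[OF val]
      by (intro conjI[OF fits])
        (simp add: wp_simps s' kx V o one im Q'[symmetric] imgQ' del: image_insert)
  next
    case False
    have val: "\<not> expr_val (Op Plus (Op Equal (Read ''F'' (Reg ''x'')) (Op Div (Reg ''z'') (Reg ''q'')))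
              (Op Equal (Read ''F'' (Reg ''x'')) (Op Mod (Reg ''z'') (Reg ''q'')))) s' \<noteq> 0"
      using False by (simp add: s' kx)
    have "same {''x'', ''o''} {''Q''} s (s'\<lparr>reg := (reg s')(''x'' := Suc k)\<rparr>)"
      using sm by (simp add: same_def)
    with False ol old show ?thesis
      unfolding eq wp_Cond if_not_P[OF val]
      by (intro conjI[OF fits]) (simp add: wp_simps kx im)
  qed
next
  case (5 t s')
  then show ?case by (intro post) (auto simp: query_def)
qed (use s w in \<open>auto simp: same_def\<close>)

text \<open>Writing \<open>off\<close> after the increment of \<open>size\<close> records the end of
  the current set and the start of the next at once.\<close>

definition write_queries :: com where
  "write_queries = For ''z'' (Op Times (Reg ''q'') (Reg ''q'')) (Seq write_query
     (Seq (Assign ''size'' (Op Plus (Reg ''size'') (Const 1)))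
          (Store ''off'' (Reg ''size'') (Reg ''o''))))"

lemma wp_write_queries:
  assumes s: "reg s ''n'' = length vs" "reg s ''q'' = q"
      "\<forall>x<length vs. arr s ''F'' x < q" "\<forall>x<length vs. arr s ''V'' x = vs ! x \<and> vs ! x < 2 ^ w"
      "outs (length vs) s Qs" "0 < length vs"
    and w: "2 < (2::nat) ^ w" "q * q < 2 ^ w" "(length Qs + q * q) * length vs < 2 ^ w"
    and post: "\<And>t s'. t \<le> q * q * (30 * length vs + 23) + 8 \<Longrightarrow>
      same {''x'', ''o'', ''z'', ''size''} {''Q'', ''off''} s s' \<Longrightarrow>
      outs (length vs) s' (Qs @ map (query vs q (arr s ''F'')) [0..<q * q]) \<Longrightarrow> Q t s'"
  shows "wp w write_queries Q s"
  unfolding write_queries_def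
proof (rule wp_For[where N = "q * q" and T = "\<lambda>_. 30 * length vs + 13" and
      I = "\<lambda>k s'. same {''x'', ''o'', ''z'', ''size''} {''Q'', ''off''} s s' \<and>
      outs (length vs) s' (Qs @ map (query vs q (arr s ''F'')) [0..<k])"], goal_cases)
  case 2
  then show ?case using s by (auto simp: same_def outs_def outputs_family_def)
next
  case (4 k s')
  have q: "q < 2 ^ w" using w(2) le_square[of q] by linarith
  let ?Qs = "Qs @ map (query vs q (arr s ''F'')) [0..<k]"
  note s' = same_reg[OF 4(3)[THEN conjunct1]] same_arr[OF 4(3)[THEN conjunct1]]
  have outs: "outs (length vs) s' ?Qs" using 4 by blast
  \<comment> \<open>As \<open>vs\<close> is nonempty, the bound on the space for the elements also
    bounds the number of sets.\<close>
  have len: "length ?Qs < length Qs + q * q" "length ?Qs < 2 ^ w" "Suc (length ?Qs) < 2 ^ w"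
  proof -
    show *: "length ?Qs < length Qs + q * q" using 4 by simp
    have "Suc (length ?Qs) * 1 \<le> (length Qs + q * q) * length vs"
      using * s by (intro mult_le_mono) (auto simp: Suc_le_eq)
    from le_less_trans[OF this w(3)] show "Suc (length ?Qs) < 2 ^ w" by (simp only: mult_1_right)
    then show "length ?Qs < 2 ^ w" by linarith
  qed
  have o: "reg s' ''o'' + length vs < 2 ^ w"
  proof -
    have "reg s' ''o'' + length vs \<le> length ?Qs * length vs + length vs"
      using outs by (simp add: outs_def)
    also have "\<dots> = Suc (length ?Qs) * length vs" by simp
    also have "\<dots> \<le> (length Qs + q * q) * length vs" using len by (intro mult_le_mono1) auto
    finally show ?thesis using w by linarith
  qed
  show ?case
    unfolding wp_Seq
  proof (rule wp_write_query[where q = q and vs = vs], goal_cases)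
    case (9 t s2)
    note s2 = same_reg[OF 9(2)] same_arr[OF 9(2)]
    have sz: "reg s2 ''size'' = length ?Qs" using outs by (simp add: s2 outs_def outputs_family_def)
    have o2: "reg s2 ''o'' < 2 ^ w" using 9 o by linarith
    let ?s = "s2\<lparr>reg := (reg s2)(''size'' := Suc (length ?Qs))\<rparr>"
    let ?s = "?s\<lparr>arr := (arr ?s)(''off'' := (arr ?s ''off'')(Suc (length ?Qs) := reg s2 ''o''))\<rparr>"
    have F: "arr s' ''F'' = arr s ''F''" and z: "reg s' ''z'' = k" using 4(2) by (simp_all add: s')
    have "outs (length vs) (?s\<lparr>reg := (reg ?s)(''z'' := Suc k)\<rparr>) (?Qs @ [query vs q (arr s ''F'') k])"
      by (rule outs_snoc[OF outs]) (use 9 in \<open>simp_all add: s2 F z\<close>)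
    moreover have "same {''x'', ''o'', ''z'', ''size''} {''Q'', ''off''} s (?s\<lparr>reg := (reg ?s)(''z'' := Suc k)\<rparr>)"
      using 4(3) 9(2) by (simp add: same_def)
    moreover have "1 < (2::nat) ^ w" "Suc 0 < (2::nat) ^ w" using w(1) by linarith+
    moreover have "Suc (length Qs + k) < 2 ^ w" "length Qs + k < 2 ^ w" using len by simp_all
    ultimately show ?case
      using 9(1) sz o2 z by (simp add: wp_simps s2)
  qed (use s w q o 4 in \<open>simp_all add: s'\<close>)
next
  case (3 k s')
  have "q < 2 ^ w" using w(2) le_square[of q] by linarith
  with s w(2) show ?case by (simp add: same_reg[OF 3(3)[THEN conjunct1]])
next
  case (5 t s')
  show ?case by (rule post) (use 5(1,3) in \<open>simp_all add: algebra_simps\<close>)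
qed (rule w(2))

section \<open>Iteration and the potential argument\<close>

definition main_loop :: com where
  "main_loop = For ''j'' (Op Times (Reg ''q'') (Reg ''K'')) (Seq build_code write_queries)"

text \<open>Dividing by \<open>q ^ k\<close> gives growth by at most
  \<open>(1 + 1 / q) ^ (q * K)\<close>, and \<open>(1 + 1 / q) ^ q \<le> exp 1 \<le> 4\<close>. So
  the initial \<open>2 ^ K\<close> grows to at most \<open>4 ^ K * 2 ^ K\<close>.\<close>

lemma potential_bound:
  fixes S q K k :: nat
  assumes "0 < q" "k \<le> q * K" "q ^ k * S \<le> (q + 1) ^ k * 2 ^ K"
  shows "S \<le> 8 ^ K"
proof -
  have "real q ^ k * real S \<le> (real q + 1) ^ k * 2 ^ K"
    using assms(3) by (simp flip: of_nat_le_iff[where 'a = real] add: add.commute)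
  then have "real S \<le> (1 + 1 / real q) ^ k * 2 ^ K"
    using assms(1) by (simp add: field_simps power_divide flip: power_mult_distrib)
  also have "\<dots> \<le> (1 + 1 / real q) ^ (q * K) * 2 ^ K"
    using assms(2) by (intro mult_right_mono power_increasing) auto
  also have "(1 + 1 / real q) ^ (q * K) = ((1 + 1 / real q) ^ q) ^ K" by (rule power_mult)
  also have "\<dots> \<le> 4 ^ K"
  proof (rule power_mono)
    have "(1 + 1 / real q) ^ q \<le> exp (1 / real q) ^ q" by (intro power_mono exp_ge_add_one_self) auto
    also have "\<dots> = exp 1" using assms(1) by (simp flip: exp_of_nat_mult)
    also have "\<dots> \<le> 4" using exp_le by linarith
    finally show "(1 + 1 / real q) ^ q \<le> 4" .
  qed simp
  finally have "real S \<le> 4 ^ K * 2 ^ K" by simp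
  then have "real S \<le> real (8 ^ K)" by (simp flip: power_mult_distrib)
  then show ?thesis by (rule of_nat_le_iff[THEN iffD1])
qed

text \<open>The list \<open>Fs\<close> exists only in the proof: the program stores the latest
  function, and of the earlier ones it remembers the zero counts as exponents of the weights. The
  potential inequality is multiplied out by \<open>q ^ k\<close> to stay within the natural
  numbers.\<close>

definition progress :: "nat \<Rightarrow> nat \<Rightarrow> nat list \<Rightarrow> nat \<Rightarrow> state \<Rightarrow> (nat \<Rightarrow> nat) list \<Rightarrow> bool" where
  "progress K r vs k s Fs \<longleftrightarrow> length Fs = k \<and> (\<forall>F\<in>set Fs. linear_upto (2 ^ K) r F) \<and>
     (\<forall>x. 0 < x \<and> x < 2 ^ K \<longrightarrow> arr s ''wt'' x = 2 ^ zeros Fs x) \<and>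
     (2 ^ r) ^ k * (\<Sum>x\<in>{0<..<2 ^ K}. arr s ''wt'' x) \<le> (2 ^ r + 1) ^ k * 2 ^ K \<and>
     arr s ''F'' 0 = 0 \<and> outs (length vs) s (queries vs (2 ^ r) Fs)"

lemma progress_weight:
  assumes "progress K r vs k s Fs" "k \<le> 2 ^ r * K"
  shows "(\<Sum>x\<in>{0<..<2 ^ K}. arr s ''wt'' x) \<le> 8 ^ K"
  using assms by (intro potential_bound[where q = "2 ^ r" and k = k]) (auto simp: progress_def)

text \<open>A single weight is at most the total \<open>8 ^ K = 2 ^ (3 * K)\<close>; compare
  exponents.\<close>

lemma progress_zeros:
  assumes "progress K r vs k s Fs" "k \<le> 2 ^ r * K" "0 < x" "x < 2 ^ K"
  shows "zeros Fs x \<le> 3 * K"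
proof -
  have "2 ^ zeros Fs x = arr s ''wt'' x" using assms by (simp add: progress_def)
  also have "\<dots> \<le> (\<Sum>x\<in>{0<..<2 ^ K}. arr s ''wt'' x)"
    using assms by (intro member_le_sum) auto
  also have "\<dots> \<le> 8 ^ K" using assms by (intro progress_weight)
  also have "\<dots> = 2 ^ (3 * K)" by (simp add: power_mult)
  finally show ?thesis by simp
qed

lemma progress_Suc:
  assumes pr: "progress K r vs k s Fs" and bt: "built K r (arr s ''wt'') (arr s' ''F'') (arr s' ''wt'')"
    and outs: "outs (length vs) s' (queries vs (2 ^ r) Fs @ map (query vs (2 ^ r) (arr s' ''F'')) [0..<2 ^ r * 2 ^ r])"
  shows "progress K r vs (Suc k) s' (Fs @ [arr s' ''F''])"
proof -
  have lin: "linear_upto (2 ^ K) r (arr s' ''F'')" using bt by (simp add: built_def)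
  \<comment> \<open>Linearity forces the value 0 at 0, from which the next construction
    starts.\<close>
  then have "arr s' ''F'' (0 XOR 0) = arr s' ''F'' 0 XOR arr s' ''F'' 0"
    unfolding linear_upto_def by (metis zero_less_numeral zero_less_power)
  then have F0: "arr s' ''F'' 0 = 0" by simp
  have "2 ^ r * (\<Sum>x\<in>{0<..<2 ^ K}. arr s' ''wt'' x) \<le> (2 ^ r + 1) * (\<Sum>x\<in>{0<..<2 ^ K}. arr s ''wt'' x)"
    using bt unfolding built_def by blast
  then have "(2 ^ r) ^ Suc k * (\<Sum>x\<in>{0<..<2 ^ K}. arr s' ''wt'' x)
      \<le> (2 ^ r) ^ k * ((2 ^ r + 1) * (\<Sum>x\<in>{0<..<2 ^ K}. arr s ''wt'' x))"
    unfolding power_Suc2 mult.assoc by (rule mult_le_mono2)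
  also have "\<dots> = (2 ^ r + 1) * ((2 ^ r) ^ k * (\<Sum>x\<in>{0<..<2 ^ K}. arr s ''wt'' x))"
    by (simp only: mult.left_commute)
  also have "\<dots> \<le> (2 ^ r + 1) * ((2 ^ r + 1) ^ k * 2 ^ K)"
    using pr unfolding progress_def by (intro mult_le_mono2) blast
  also have "\<dots> = (2 ^ r + 1) ^ Suc k * 2 ^ K" by (simp only: power_Suc mult.assoc)
  finally have pot: "(2 ^ r) ^ Suc k * (\<Sum>x\<in>{0<..<2 ^ K}. arr s' ''wt'' x) \<le> (2 ^ r + 1) ^ Suc k * 2 ^ K" .
  have wt: "arr s' ''wt'' x = 2 ^ zeros (Fs @ [arr s' ''F'']) x" if "0 < x" "x < 2 ^ K" for x
    using pr bt that by (simp add: progress_def built_def zeros_def)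
  show ?thesis
    unfolding progress_def queries_snoc using pr lin F0 pot wt outs by (auto simp: progress_def simp del: power_Suc)
qed

lemma wp_main_loop:
  assumes s: "reg s ''n'' = length vs" "reg s ''q'' = 2 ^ r" "reg s ''K'' = K" "reg s ''N'' = 2 ^ K"
      "\<forall>x<length vs. arr s ''V'' x = vs ! x \<and> vs ! x < 2 ^ w" "0 < length vs" "length vs \<le> 2 ^ K"
      "is_xor_table (2 ^ r) (arr s ''X'')" "progress K r vs 0 s []"
    and w: "2 < (2::nat) ^ w" "2 * 8 ^ K < (2::nat) ^ w" "2 ^ r * 2 ^ r < (2::nat) ^ w" "2 ^ r * K < 2 ^ w"
      "2 ^ r * K * (2 ^ r * 2 ^ r) * length vs < 2 ^ w"
    and post: "\<And>t s' Fs. t \<le> 2 ^ r * K *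
        (27 * 2 ^ r * K + 55 * 2 ^ K + 34 * K + 24 + 2 ^ r * 2 ^ r * (30 * length vs + 23)) + 8 \<Longrightarrow>
      progress K r vs (2 ^ r * K) s' Fs \<Longrightarrow> Q t s'"
  shows "wp w main_loop Q s"
  unfolding main_loop_def
proof (rule wp_For[where N = "2 ^ r * K" and I = "\<lambda>k s'.
      same {''j'', ''a'', ''y'', ''b'', ''h'', ''x'', ''o'', ''z'', ''size''} {''B'', ''F'', ''wt'', ''Q'', ''off''} s s' \<and>
      (\<exists>Fs. progress K r vs k s' Fs)" and
      T = "\<lambda>_. 27 * 2 ^ r * K + 55 * 2 ^ K + 34 * K + 14 + 2 ^ r * 2 ^ r * (30 * length vs + 23)"], goal_cases)
  case 2
  have "progress K r vs 0 (s\<lparr>reg := (reg s)(''j'' := 0)\<rparr>) []"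
    using s by (auto simp: progress_def outs_def outputs_family_def)
  then show ?case by (auto simp: same_def)
next
  case (3 k s')
  note s' = same_reg[OF 3(3)[THEN conjunct1]]
  have "(2::nat) ^ r < 2 ^ w" using w(3) le_square[of "2 ^ r"] by linarith
  moreover have "K \<le> 2 ^ r * K" by simp
  then have "K < 2 ^ w" using w(4) by linarith
  ultimately show ?case using s w(4) by (simp add: s')
next
  case (4 k s')
  then obtain Fs where pr: "progress K r vs k s' Fs" by blast
  note s' = same_reg[OF 4(3)[THEN conjunct1]] same_arr[OF 4(3)[THEN conjunct1]]
  have "(2::nat) ^ K \<le> 8 ^ K" by (intro power_mono) auto
  then have K: "2 ^ K < (2::nat) ^ w" using w(2) by linarith
  have S: "2 * (\<Sum>x\<in>{0<..<2 ^ K}. arr s' ''wt'' x) < 2 ^ w"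
    using progress_weight[OF pr] 4(1) w(2) by linarith
  \<comment> \<open>The space used up to the end of this round is at most that of all
    \<open>2 ^ r * K\<close> rounds, which fits into a word.\<close>
  have "(k * (2 ^ r * 2 ^ r) + 2 ^ r * 2 ^ r) * length vs \<le> 2 ^ r * K * (2 ^ r * 2 ^ r) * length vs"
  proof (rule mult_le_mono1)
    have "Suc k * (2 ^ r * 2 ^ r) \<le> 2 ^ r * K * (2 ^ r * 2 ^ r)" using 4(1) by (intro mult_le_mono1) simp
    then show "k * (2 ^ r * 2 ^ r) + 2 ^ r * 2 ^ r \<le> 2 ^ r * K * (2 ^ r * 2 ^ r)" by simp
  qed
  moreover have "length (queries vs (2 ^ r) Fs) = k * (2 ^ r * 2 ^ r)"
    using pr by (simp add: length_queries progress_def)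
  ultimately have len: "(length (queries vs (2 ^ r) Fs) + 2 ^ r * 2 ^ r) * length vs < 2 ^ w"
    using w(5) by (simp only: le_less_trans)
  show ?case
    unfolding wp_Seq
  proof (rule wp_build_code[where K = K and r = r], goal_cases)
    case (9 t1 s1)
    note s1 = same_reg[OF 9(2)] same_arr[OF 9(2)]
    show ?case
    proof (rule wp_write_queries[where vs = vs and q = "2 ^ r" and Qs = "queries vs (2 ^ r) Fs"], goal_cases)
      case 3
      show ?case using 9(3) s(7) by (simp add: built_def linear_upto_def)
    next
      case 5
      show ?case using pr by (auto simp: progress_def outs_def outputs_family_def s1)
    next
      case 7
      show ?case by (rule w(1))
    next
      case (10 t2 s2)
      note s2 = same_reg[OF 10(2)] same_arr[OF 10(2)]
      have "progress K r vs (Suc k) s2 (Fs @ [arr s2 ''F''])"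
        using 9(3) 10(3) by (intro progress_Suc[OF pr]) (simp_all add: s2)
      then have "progress K r vs (Suc k) (s2\<lparr>reg := (reg s2)(''j'' := Suc k)\<rparr>) (Fs @ [arr s2 ''F''])"
        by (auto simp: progress_def outs_def outputs_family_def)
      moreover have "same {''j'', ''a'', ''y'', ''b'', ''h'', ''x'', ''o'', ''z'', ''size''}
          {''B'', ''F'', ''wt'', ''Q'', ''off''} s (s2\<lparr>reg := (reg s2)(''j'' := Suc k)\<rparr>)"
        using 4(3) 9(2) 10(2) by (simp add: same_def)
      moreover have "reg s2 ''j'' = k" using 4(2) by (simp add: s1 s2)
      ultimately show ?case using 9(1) 10(1) by auto
    qed (use s w len in \<open>simp_all add: s1 s'\<close>)
  next
    case 5
    show ?case by (rule w(1))
  qed (use s w pr K S in \<open>simp_all add: s' progress_def\<close>)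
next
  case (5 t s')
  then obtain Fs where pr: "progress K r vs (2 ^ r * K) s' Fs" by blast
  show ?case by (rule post[OF _ pr]) (use 5(1) in \<open>simp add: algebra_simps\<close>)
qed (use w in simp)


section \<open>Initialisation and parameters\<close>

text \<open>The threshold \<open>6 * p\<close> arises as \<open>2 * p\<close> pairs times
  \<open>3 * K\<close> zeros, compared with \<open>q * K\<close> functions.\<close>

definition find_alphabet :: com where
  "find_alphabet = Seq (Assign ''q'' (Const 1))
     (While (Op Less (Reg ''q'') (Op Plus (Op Times (Const 6) (Reg ''p'')) (Const 1)))
       (Assign ''q'' (Op Times (Const 2) (Reg ''q''))))"

lemma wp_find_alphabet:
  assumes s: "reg s ''p'' = p" "6 * p < 2 ^ r" "\<forall>i<r. 2 ^ i \<le> 6 * p"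
    and w: "6 < (2::nat) ^ w" "6 * p + 1 < 2 ^ w" "(2::nat) ^ r < 2 ^ w"
    and post: "\<And>t s'. t \<le> 12 * r + 10 \<Longrightarrow> same {''q''} {} s s' \<Longrightarrow> reg s' ''q'' = 2 ^ r \<Longrightarrow> Q t s'"
  shows "wp w find_alphabet Q s"
  unfolding find_alphabet_def wp_Seq wp_Assign
proof (intro conjI, use w in simp, rule wp_While[where N = r and T = "\<lambda>_. 4"
      and I = "\<lambda>i s'. same {''q''} {} s s' \<and> reg s' ''q'' = 2 ^ i"], goal_cases)
  case (2 i s')
  have sm: "same {''q''} {} s s'" and q: "reg s' ''q'' = 2 ^ i" and p: "reg s' ''p'' = p"
    using 2(2) s(1) by (auto simp: same_def)
  have "(2::nat) ^ Suc i \<le> 2 ^ r" using 2 by (intro power_increasing) auto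
  then have i: "2 * 2 ^ i < (2::nat) ^ w" "2 ^ i < (2::nat) ^ w" using w(3) unfolding power_Suc by linarith+
  have le: "2 ^ i \<le> 6 * p" using 2(1) s(3) by blast
  have c: "2 < (2::nat) ^ w" "1 < (2::nat) ^ w" "0 < (2::nat) ^ w" "Suc 0 < (2::nat) ^ w" "6 * p < 2 ^ w" "p < 2 ^ w"
    using w(1,2) by linarith+
  have c': "Suc (6 * p) < 2 ^ w" using w(2) by simp
  have "same {''q''} {} s (s'\<lparr>reg := (reg s')(''q'' := 2 * 2 ^ i)\<rparr>)" using sm by (simp add: same_def)
  moreover have "expr_fits w (Op Less (Reg ''q'') (Op Plus (Op Times (Const 6) (Reg ''p'')) (Const 1))) s'"
    using w(1) by (simp add: q p i(2) c c')
  moreover have "expr_fits w (Op Times (Const 2) (Reg ''q'')) s'" using i c(1) by (simp add: q)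
  ultimately show ?case using le by (simp add: wp_Assign q p del: expr_fits.simps)
next
  case (3 s')
  have c: "1 < (2::nat) ^ w" "0 < (2::nat) ^ w" "Suc 0 < (2::nat) ^ w" "6 * p < 2 ^ w" "p < 2 ^ w"
    using w(1,2) by linarith+
  have c': "Suc (6 * p) < 2 ^ w" using w(2) by simp
  have "reg s' ''q'' = 2 ^ r" "reg s' ''p'' = p" using 3 s(1) by (auto simp: same_def)
  then show ?case using s(2) w(1,3) by (simp add: c c')
next
  case (4 t s')
  then show ?case by (intro post) auto
qed (simp add: same_def)

definition find_length :: com where
  "find_length = Seq (Assign ''N'' (Const 1))
     (While (Op Less (Reg ''N'') (Reg ''n''))
       (Seq (Assign ''N'' (Op Times (Const 2) (Reg ''N'')))
            (Assign ''K'' (Op Plus (Reg ''K'') (Const 1)))))"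

lemma wp_find_length:
  assumes s: "reg s ''n'' = n" "reg s ''K'' = 0" "n \<le> 2 ^ K" "\<forall>i<K. 2 ^ i < n"
    and w: "2 < (2::nat) ^ w" "(2::nat) ^ K < 2 ^ w"
    and post: "\<And>t s'. t \<le> 12 * K + 6 \<Longrightarrow> same {''N'', ''K''} {} s s' \<Longrightarrow> reg s' ''N'' = 2 ^ K \<Longrightarrow>
      reg s' ''K'' = K \<Longrightarrow> Q t s'"
  shows "wp w find_length Q s"
  unfolding find_length_def wp_Seq wp_Assign
proof (intro conjI, use w in simp, rule wp_While[where N = K and T = "\<lambda>_. 8"
      and I = "\<lambda>i s'. same {''N'', ''K''} {} s s' \<and> reg s' ''N'' = 2 ^ i \<and> reg s' ''K'' = i"], goal_cases)
  case (2 i s')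
  have sm: "same {''N'', ''K''} {} s s'" and N: "reg s' ''N'' = 2 ^ i" "reg s' ''K'' = i" and n: "reg s' ''n'' = n"
    using 2(2) s(1) by (auto simp: same_def)
  have "(2::nat) ^ Suc i \<le> 2 ^ K" using 2 by (intro power_increasing) auto
  then have i: "2 * 2 ^ i < (2::nat) ^ w" "2 ^ i < (2::nat) ^ w" using w(2) unfolding power_Suc by linarith+
  have "i < 2 ^ i" by simp
  then have i': "i < 2 ^ w" "Suc i < 2 ^ w" using i by linarith+
  have nw: "n < 2 ^ w" using s(3) w(2) by linarith
  have le: "2 ^ i < n" using 2(1) s(4) by blast
  have c: "1 < (2::nat) ^ w" "0 < (2::nat) ^ w" "Suc 0 < (2::nat) ^ w"
    using w(1) by linarith+
  have "same {''N'', ''K''} {} s (s'\<lparr>reg := (reg s')(''N'' := 2 * 2 ^ i, ''K'' := Suc i)\<rparr>)"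
    using sm by (simp add: same_def)
  with le i w(1) show ?case by (simp add: wp_simps N n c i' nw)
next
  case (3 s')
  have "reg s' ''N'' = 2 ^ K" "reg s' ''n'' = n" using 3 s(1) by (auto simp: same_def)
  moreover have nw: "n < 2 ^ w" using s(3) w by linarith
  ultimately show ?case using s(3) w(2) by (simp add: nw)
next
  case (4 t s')
  then show ?case by (intro post) auto
qed (use s in \<open>simp add: same_def\<close>)

text \<open>Entry 0 refers to itself, which is sound because memory is initially 0.\<close>

definition fill_xor_table :: com where
  "fill_xor_table = For ''z'' (Op Times (Reg ''q'') (Reg ''q''))
     (Store ''X'' (Reg ''z'') (Op Plus
       (Op Times (Const 2) (Read ''X'' (Op Plus
         (Op Times (Op Div (Op Div (Reg ''z'') (Reg ''q'')) (Const 2)) (Reg ''q''))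
         (Op Div (Op Mod (Reg ''z'') (Reg ''q'')) (Const 2)))))
       (Op Mod (Op Plus (Op Div (Reg ''z'') (Reg ''q'')) (Op Mod (Reg ''z'') (Reg ''q''))) (Const 2))))"

text \<open>The lowest bit of the exclusive or is the parity of the sum. Each table entry thus
  follows by arithmetic from the entry of the halved pair.\<close>

lemma xor_rec_nat: "a XOR b = 2 * ((a div 2) XOR (b div 2)) + (a + b) mod 2" for a b :: nat
proof -
  have "(a + b) mod 2 = of_bool (odd a \<noteq> odd b)" by (auto simp: mod_2_eq_odd)
  then show ?thesis using xor_rec[of a b] by simp
qed

lemma wp_fill_xor_table:
  assumes s: "reg s ''q'' = 2 ^ r" "arr s ''X'' 0 = 0"
    and w: "2 < (2::nat) ^ w" "2 ^ r * 2 ^ r < (2::nat) ^ w" "2 * 2 ^ r < (2::nat) ^ w"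
    and post: "\<And>t s'. t \<le> 38 * (2 ^ r * 2 ^ r) + 8 \<Longrightarrow> same {''z''} {''X''} s s' \<Longrightarrow>
      is_xor_table (2 ^ r) (arr s' ''X'') \<Longrightarrow> Q t s'"
  shows "wp w fill_xor_table Q s"
proof -
  define q where "q = (2::nat) ^ r"
  have q: "0 < q" "q < 2 ^ w" "q * q < 2 ^ w" "2 * q < 2 ^ w"
    using w(2,3) unfolding q_def by (simp, linarith+)
  note s' = s(1)[folded q_def] s(2)
  show ?thesis
    unfolding fill_xor_table_def
  proof (rule wp_For[where N = "q * q" and T = "\<lambda>_. 28" and I = "\<lambda>k s'. same {''z''} {''X''} s s' \<and>
      arr s' ''X'' 0 = 0 \<and> (\<forall>z<k. arr s' ''X'' z = (z div q) XOR (z mod q))"], goal_cases)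
    case (3 k s')
    have "reg s' ''q'' = q" using 3 s' by (auto simp: same_def)
    with q show ?case by simp
  next
    case (4 k s')
    have sm: "same {''z''} {''X''} s s'" and rq: "reg s' ''q'' = q" and X0: "arr s' ''X'' 0 = 0"
      and X: "\<And>z. z < k \<Longrightarrow> arr s' ''X'' z = (z div q) XOR (z mod q)" and z: "reg s' ''z'' = k"
      using 4 s' by (auto simp: same_def)
    define a b where "a = k div q" and "b = k mod q"
    have ab: "a < q" "b < q" "k = a * q + b"
      using 4(1) q by (auto simp: a_def b_def less_mult_imp_div_less)
    \<comment> \<open>The code of the halved pair. It is smaller than \<open>k\<close> unless
      \<open>k = 0\<close>, so its entry is already correct; for \<open>k = 0\<close> it is the
      initial 0 itself.\<close>
    define i where "i = a div 2 * q + b div 2"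
    have i1: "a div 2 * q \<le> i" by (simp add: i_def)
    have ik: "i \<le> k" unfolding i_def ab(3) by (intro add_mono mult_le_mono1) auto
    have Xi: "arr s' ''X'' i = (a div 2) XOR (b div 2)"
    proof (cases "k = 0")
      case True
      then show ?thesis using X0 q by (simp add: i_def a_def b_def)
    next
      case False
      have "i < k"
      proof (cases "a = 0")
        case True
        then show ?thesis using False ab by (simp add: i_def)
      next
        case False
        then have "a div 2 * q < a * q" using q by simp
        moreover have "b div 2 \<le> b" by simp
        ultimately show ?thesis unfolding i_def ab(3) by (rule add_less_le_mono)
      qed
      moreover have "i div q = a div 2" "i mod q = b div 2"
        using ab by (simp_all add: i_def)
      ultimately show ?thesis using X by simp
    qed
    have val: "2 * arr s' ''X'' i + (a + b) mod 2 = a XOR b"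
      unfolding Xi by (rule xor_rec_nat[symmetric])
    have lt: "a XOR b < q" using ab unfolding q_def by (intro xor_lt) auto
    have bounds: "2 * arr s' ''X'' i < 2 ^ w" "arr s' ''X'' i < 2 ^ w" "i < 2 ^ w" "k < 2 ^ w" "a + b < 2 ^ w"
      "a div 2 * q < 2 ^ w" "a < 2 ^ w" "b < 2 ^ w" "a div 2 < 2 ^ w" "b div 2 < 2 ^ w"
      "(a + b) mod 2 < 2 ^ w" "a XOR b < 2 ^ w"
      using val lt ab(1,2) q ik 4(1) i1 w(1) by linarith+
    have "expr_fits w (Op Plus
       (Op Times (Const 2) (Read ''X'' (Op Plus
         (Op Times (Op Div (Op Div (Reg ''z'') (Reg ''q'')) (Const 2)) (Reg ''q''))
         (Op Div (Op Mod (Reg ''z'') (Reg ''q'')) (Const 2)))))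
       (Op Mod (Op Plus (Op Div (Reg ''z'') (Reg ''q'')) (Op Mod (Reg ''z'') (Reg ''q''))) (Const 2))) s'"
      using bounds w(1) q val
      by (simp only: expr_fits.simps expr_val.simps binop_val.simps z rq a_def[symmetric] b_def[symmetric] i_def[symmetric] simp_thms)
    moreover have "expr_val (Op Plus
       (Op Times (Const 2) (Read ''X'' (Op Plus
         (Op Times (Op Div (Op Div (Reg ''z'') (Reg ''q'')) (Const 2)) (Reg ''q''))
         (Op Div (Op Mod (Reg ''z'') (Reg ''q'')) (Const 2)))))
       (Op Mod (Op Plus (Op Div (Reg ''z'') (Reg ''q'')) (Op Mod (Reg ''z'') (Reg ''q''))) (Const 2))) s' = a XOR b"
      by (simp only: expr_val.simps binop_val.simps z rq a_def[symmetric] b_def[symmetric] i_def[symmetric] val)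
    moreover have "k = 0 \<Longrightarrow> a XOR b = 0" by (simp add: a_def b_def)
    ultimately show ?case
      unfolding wp_Store
      using bounds(4) sm X X0 z
      by (simp del: expr_fits.simps(4) expr_val.simps(4) add: less_Suc_eq all_conj_distrib a_def b_def)
        (auto simp: same_def)
  next
    case (5 t s')
    show ?case by (rule post) (use 5 in \<open>simp_all add: is_xor_table_def q_def algebra_simps\<close>)
  qed (use q s' in \<open>simp_all add: same_def\<close>)
qed

definition init_weights :: com where
  "init_weights = For ''x'' (Reg ''N'') (Store ''wt'' (Reg ''x'') (Const 1))"

lemma wp_init_weights:
  assumes s: "reg s ''N'' = N" and w: "1 < (2::nat) ^ w" "N < 2 ^ w"
    and post: "\<And>t s'. t \<le> 11 * N + 6 \<Longrightarrow> same {''x''} {''wt''} s s' \<Longrightarrow> \<forall>x<N. arr s' ''wt'' x = 1 \<Longrightarrow> Q t s'"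
  shows "wp w init_weights Q s"
  unfolding init_weights_def
proof (rule wp_For[where N = N and T = "\<lambda>_. 3" and I = "\<lambda>k s'. same {''x''} {''wt''} s s' \<and>
    (\<forall>x<k. arr s' ''wt'' x = 1)"], goal_cases)
  case (4 k s')
  have "Suc 0 < (2::nat) ^ w" using w(1) by simp
  with 4 s w show ?case by (auto simp: wp_simps same_def less_Suc_eq)
qed (use s w post in \<open>auto simp: same_def\<close>)

definition scheme_program :: com where
  "scheme_program = Seq find_alphabet (Seq find_length (Seq fill_xor_table (Seq init_weights main_loop)))"

lemma least_power_of_2:
  fixes c :: nat
  obtains r :: nat where "c \<le> 2 ^ r" "\<forall>i<r. 2 ^ i < c"
proof
  define r where "r = (LEAST i. c \<le> 2 ^ i)"
  have "c \<le> 2 ^ c" by (simp add: less_imp_le)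
  then show "c \<le> 2 ^ r" unfolding r_def by (rule LeastI)
  show "\<forall>i<r. 2 ^ i < c" unfolding r_def using not_less_Least by (metis not_le)
qed

lemma wp_scheme_program:
  assumes r: "6 * p < 2 ^ r" "\<forall>i<r. 2 ^ i \<le> 6 * p" and K: "length vs \<le> 2 ^ K" "\<forall>i<K. 2 ^ i < length vs"
    and V: "\<forall>x<length vs. vs ! x < 2 ^ w" "0 < length vs"
    and w: "6 < (2::nat) ^ w" "6 * p + 1 < 2 ^ w" "2 * 8 ^ K < (2::nat) ^ w" "2 * (2 ^ r * 2 ^ r) < (2::nat) ^ w"
      "2 ^ r * K < 2 ^ w" "2 ^ r * K * (2 ^ r * 2 ^ r) * length vs < 2 ^ w"
    and post: "\<And>t s' Fs. t \<le> (12 * r + 10) + (12 * K + 6) + (38 * (2 ^ r * 2 ^ r) + 8) + (11 * 2 ^ K + 6) +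
        (2 ^ r * K * (27 * 2 ^ r * K + 55 * 2 ^ K + 34 * K + 24 + 2 ^ r * 2 ^ r * (30 * length vs + 23)) + 8) \<Longrightarrow>
      progress K r vs (2 ^ r * K) s' Fs \<Longrightarrow> Q t s'"
  shows "wp w scheme_program Q (input_state vs p)"
proof -
  let ?s = "input_state vs p"
  have c: "2 < (2::nat) ^ w" "1 < (2::nat) ^ w" using w(1) by linarith+
  have "(2::nat) ^ K \<le> 8 ^ K" by (intro power_mono) auto
  then have Kw: "(2::nat) ^ K < 2 ^ w" using w(3) by linarith
  have "(2::nat) ^ r * 1 \<le> 2 ^ r * 2 ^ r" by (intro mult_le_mono2) simp
  then have rw: "(2::nat) ^ r < 2 ^ w" "2 * 2 ^ r < (2::nat) ^ w" "2 ^ r * 2 ^ r < (2::nat) ^ w"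
    using w(4) by linarith+
  show ?thesis
    unfolding scheme_program_def wp_Seq
  proof (rule wp_find_alphabet[where p = p and r = r], goal_cases)
    case (7 t1 s1)
    note s1 = same_reg[OF 7(2)] same_arr[OF 7(2)]
    show ?case
    proof (rule wp_find_length[where n = "length vs" and K = K], goal_cases)
      case (7 t2 s2)
      note s2 = same_reg[OF 7(2)] same_arr[OF 7(2)]
      show ?case
      proof (rule wp_fill_xor_table[where r = r], goal_cases)
        case (6 t3 s3)
        note s3 = same_reg[OF 6(2)] same_arr[OF 6(2)]
        show ?case
        proof (rule wp_init_weights[where N = "2 ^ K"], goal_cases)
          case (4 t4 s4)
          note s4 = same_reg[OF 4(2)] same_arr[OF 4(2)]
          \<comment> \<open>With no functions chosen, each of the \<open>2 ^ K - 1\<close> positive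
            differences has weight \<open>2 ^ 0\<close>.\<close>
          have "(\<Sum>x\<in>{0<..<2 ^ K}. arr s4 ''wt'' x) \<le> (2::nat) ^ K"
            using 4(3) by simp
          then have pr: "progress K r vs 0 s4 []"
            using 4(3) by (simp add: progress_def zeros_def outs_def outputs_family_def queries_def
                s1 s2 s3 s4 input_state_def)
          show ?case
          proof (rule wp_main_loop[where r = r and K = K and vs = vs], goal_cases)
            case 10
            show ?case by (rule c)
          next
            case (15 t5 s5 Fs)
            show ?case
              by (rule post[OF _ 15(2)])
                (use \<open>t1 \<le> _\<close> \<open>t2 \<le> _\<close> \<open>t3 \<le> _\<close> \<open>t4 \<le> _\<close> 15(1) in linarith)
          qed (use 6 7 \<open>reg s1 ''q'' = _\<close> V K pr w rw in \<open>simp_all add: s1 s2 s3 s4 input_state_def\<close>)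
        qed (use 7 c Kw in \<open>simp_all add: s3\<close>)
      qed (use \<open>reg s1 ''q'' = _\<close> c rw in \<open>simp_all add: s1 s2 input_state_def\<close>)
    qed (use K c Kw in \<open>simp_all add: s1 input_state_def\<close>)
  qed (use r w rw in \<open>simp_all add: input_state_def\<close>)
qed


section \<open>Estimates for the running time and the word size\<close>

text \<open>Every summand is a multiple of a monomial at most \<open>q * q * q * K * n\<close>, once
  \<open>2 ^ K\<close> is replaced by \<open>2 * n\<close>. The coefficients add up to 431; rounding
  up to a power of 2 suits the final estimate.\<close>

lemma running_time_bound:
  fixes r K n q :: nat
  assumes q: "q = 2 ^ r" and K: "0 < K" "2 ^ K \<le> 2 * n" and n: "0 < n"
  shows "(12 * r + 10) + (12 * K + 6) + (38 * (q * q) + 8) + (11 * 2 ^ K + 6) +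
    (q * K * (27 * q * K + 55 * 2 ^ K + 34 * K + 24 + q * q * (30 * n + 23)) + 8) \<le> 512 * (q * q * q * K * n)"
proof -
  define Y where "Y = q * q * q * K * n"
  have le: "a \<le> Y" if "Y = a * b" "0 < b" for a b using that by simp
  have q0: "0 < q" by (simp add: q)
  have "r < q" by (simp add: q)
  moreover have "q \<le> Y" by (rule le[of _ "q * q * K * n"]) (use q0 K n in \<open>auto simp: Y_def\<close>)
  moreover have "K \<le> Y" by (rule le[of _ "q * q * q * n"]) (use q0 K n in \<open>auto simp: Y_def\<close>)
  moreover have "1 \<le> Y" by (rule le[of _ Y]) (use q0 K n in \<open>auto simp: Y_def\<close>)
  moreover have "q * q \<le> Y" by (rule le[of _ "q * K * n"]) (use q0 K n in \<open>auto simp: Y_def\<close>)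
  moreover have "n \<le> Y" by (rule le[of _ "q * q * q * K"]) (use q0 K n in \<open>auto simp: Y_def\<close>)
  moreover have "q * K * (q * n) \<le> Y" by (rule le[of _ q]) (use q0 K n in \<open>auto simp: Y_def\<close>)
  moreover have "q * K * n \<le> Y" by (rule le[of _ "q * q"]) (use q0 K n in \<open>auto simp: Y_def\<close>)
  moreover have "q * K \<le> Y" by (rule le[of _ "q * q * n"]) (use q0 K n in \<open>auto simp: Y_def\<close>)
  moreover have "q * K * (q * q) \<le> Y" by (rule le[of _ n]) (use q0 K n in \<open>auto simp: Y_def\<close>)
  \<comment> \<open>Inside the bracket \<open>K\<close> is bounded by \<open>2 * n\<close> as well,
    so that only the outer factor \<open>K\<close> remains and the logarithm enters once.\<close>
  moreover have "q * K * (27 * q * K + 55 * 2 ^ K + 34 * K + 24 + q * q * (30 * n + 23))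
      \<le> q * K * (27 * q * (2 * n) + 55 * (2 * n) + 34 * (2 * n) + 24 + q * q * (30 * n + 23))"
  proof -
    have "K \<le> 2 * n" using K(2) less_exp[of K] by linarith
    with K(2) show ?thesis by (intro mult_le_mono2 add_mono) auto
  qed
  moreover have "q * K * (27 * q * (2 * n) + 55 * (2 * n) + 34 * (2 * n) + 24 + q * q * (30 * n + 23)) =
      54 * (q * K * (q * n)) + 178 * (q * K * n) + 24 * (q * K) + 30 * Y + 23 * (q * K * (q * q))"
    by (simp add: Y_def algebra_simps)
  ultimately show ?thesis
    unfolding Y_def[symmetric] using K(2) by linarith
qed

text \<open>As \<open>2 \<le> n\<close>, constants are absorbed into powers of \<open>n\<close>. All
  quantities are then at most \<open>n ^ k\<close> with \<open>k < 20\<close>, the largest exponent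
  being \<open>5 + 2 + 10 + 1 = 18\<close>.\<close>

lemma word_size_bounds:
  fixes n p q K W :: nat
  assumes n: "2 \<le> n" "p \<le> n" "q \<le> 12 * n" "2 ^ K \<le> 2 * n" and W: "n ^ 20 \<le> W"
  shows "6 < W" "6 * p + 1 < W" "2 * 8 ^ K < W" "2 * (q * q) < W" "q * K < W" "q * K * (q * q) * n < W"
proof -
  have lt: "x < W" if "x \<le> n ^ k" "k < 20" for x k
  proof -
    have "n ^ k < n ^ 20" using n(1) that(2) by (intro power_strict_increasing) auto
    with that W show ?thesis by linarith
  qed
  have pow: "2 ^ k \<le> n ^ k" for k using n(1) by (intro power_mono) auto
  have q: "q \<le> n ^ 5"
  proof -
    have "q \<le> 2 ^ 4 * n" using n(3) by simp
    also have "\<dots> \<le> n ^ 4 * n" by (intro mult_le_mono1 pow)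
    finally show ?thesis by (simp add: eval_nat_numeral)
  qed
  have K: "K \<le> n ^ 2"
  proof -
    have "K \<le> 2 * n" using n(4) less_exp[of K] by linarith
    also have "\<dots> \<le> n * n" using n(1) by (intro mult_le_mono1)
    finally show ?thesis by (simp add: power2_eq_square)
  qed
  have "6 \<le> n ^ 3" using pow[of 3] by simp
  then show "6 < W" by (rule lt) simp
  have "6 * p + 1 \<le> 2 ^ 3 * n" using n by simp
  also have "\<dots> \<le> n ^ 3 * n ^ 1" unfolding power_one_right by (intro mult_le_mono1 pow)
  finally show "6 * p + 1 < W" unfolding power_add[symmetric] by (rule lt) simp
  have "8 ^ K = ((2::nat) ^ K) ^ 3"
    using power_mult[of "2::nat" K 3] power_mult[of "2::nat" 3 K] by (simp add: mult.commute)
  also have "\<dots> \<le> (2 * n) ^ 3" using n(4) by (intro power_mono) auto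
  finally have "2 * 8 ^ K \<le> 2 ^ 4 * n ^ 3" by (simp add: power_mult_distrib)
  also have "\<dots> \<le> n ^ 4 * n ^ 3" by (intro mult_le_mono1 pow)
  finally show "2 * 8 ^ K < W" unfolding power_add[symmetric] by (rule lt) simp
  have qq: "q * q \<le> n ^ 5 * n ^ 5" by (intro mult_le_mono q)
  have "2 * (q * q) \<le> n ^ 1 * (n ^ 5 * n ^ 5)" by (rule mult_le_mono[OF _ qq]) (use n(1) in simp)
  then show "2 * (q * q) < W" unfolding power_add[symmetric] by (rule lt) simp
  have qK: "q * K \<le> n ^ 5 * n ^ 2" by (intro mult_le_mono q K)
  then show "q * K < W" unfolding power_add[symmetric] by (rule lt) simp
  have "q * K * (q * q) * n \<le> n ^ 5 * n ^ 2 * (n ^ 5 * n ^ 5) * n ^ 1"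
    by (intro mult_le_mono qK qq) simp
  then show "q * K * (q * q) * n < W" unfolding power_add[symmetric] by (rule lt) simp
qed

theorem theorem2:
  "\<exists>(prog :: com) (a :: nat) (b :: nat) (d :: nat).
     \<forall>(V :: nat set) (n :: nat) (p :: nat) (vs :: nat list) (w :: nat).
       finite V \<and> card V = n \<and> p + 2 \<le> n \<and>
       distinct vs \<and> set vs = V \<and>
       V \<subseteq> {..<2 ^ w} \<and> real d * log 2 (real n) \<le> real w
       \<longrightarrow> (\<exists>(t :: nat) (s :: state) (Qs :: nat set list).
              exec w prog (input_state vs p) t s \<and>
              outputs_family s Qs \<and>
              query_scheme V p Qs \<and>
              real (length Qs) \<le> real (max 2 p) ^ a * log 2 (real n) \<and>
              real t \<le> real (max 2 p) ^ b * real n * log 2 (real n))"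
proof (rule exI[of _ scheme_program], rule exI[of _ 16], rule exI[of _ 25], rule exI[of _ 20],
    intro allI impI, elim conjE)
  fix V :: "nat set" and n p :: nat and vs :: "nat list" and w :: nat
  assume V: "finite V" "card V = n" "distinct vs" "set vs = V" "V \<subseteq> {..<2 ^ w}" and p: "p + 2 \<le> n"
    and w: "real 20 * log 2 (real n) \<le> real w"
  \<comment> \<open>A base of at least 2 absorbs constants even for \<open>p \<le> 1\<close>. With
    \<open>q \<le> P ^ 5\<close> and \<open>K \<le> 2 * L\<close>, the size exponent is
    \<open>15 + 1\<close>; the time exponent is \<open>15 + 10\<close>, as
    \<open>512 * 2 = 2 ^ 10\<close>.\<close>
  define P where "P = max 2 p"
  define L where "L = log 2 (real n)"
  have len: "length vs = n" using V distinct_card by fastforce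
  have n: "2 \<le> n" "p \<le> n" "0 < n" using p by auto
  have L: "1 \<le> L" using n(1) by (simp add: L_def le_log_iff)
  obtain r where r: "6 * p + 1 \<le> 2 ^ r" "\<forall>i<r. 2 ^ i < 6 * p + 1" by (rule least_power_of_2)
  obtain K where K: "n \<le> 2 ^ K" "\<forall>i<K. 2 ^ i < n" by (rule least_power_of_2)
  define q where "q = (2::nat) ^ r"
  \<comment> \<open>By minimality of \<open>r\<close>, half of \<open>q\<close> is at most
    \<open>6 * p\<close>, unless \<open>r = 0\<close> and \<open>q = 1\<close>.\<close>
  have q12: "q \<le> max 1 (12 * p)"
  proof (cases r)
    case (Suc i)
    with r(2) have "2 ^ i \<le> 6 * p" by (simp add: less_Suc_eq_le)
    then show ?thesis by (simp add: q_def Suc)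
  qed (simp add: q_def)
  have K0: "0 < K" using K(1) n(1) by (cases K) auto
  \<comment> \<open>By minimality of \<open>K\<close>, \<open>2 ^ K' < n\<close>; this bounds
    \<open>2 ^ K\<close> by \<open>2 * n\<close> and \<open>K\<close> by
    \<open>L + 1 \<le> 2 * L\<close>.\<close>
  then obtain K' where K': "K = Suc K'" using gr0_implies_Suc by blast
  have K'n: "2 ^ K' < n" using K(2) K' by simp
  have K2n: "2 ^ K \<le> 2 * n" using K'n K' by simp
  have KL: "real K \<le> 2 * L"
  proof -
    have "real (2 ^ K') \<le> real n" using K'n by (simp only: of_nat_le_iff)
    then have "real K' \<le> L" unfolding L_def by (intro le_log_of_power) simp_all
    with L show ?thesis by (simp add: K')
  qed
  have qP: "q \<le> P ^ 5"
  proof -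
    have "q \<le> 2 ^ 4 * P" using q12 by (auto simp: P_def)
    also have "\<dots> \<le> P ^ 4 * P" by (intro mult_le_mono1 power_mono) (auto simp: P_def)
    finally show ?thesis by (simp add: eval_nat_numeral)
  qed
  \<comment> \<open>Exponentiating the assumption on the word size.\<close>
  have nw: "n ^ 20 \<le> 2 ^ w"
  proof -
    have "real n ^ 20 = 2 powr (real 20 * log 2 (real n))"
      using n by (simp add: powr_realpow flip: log_powr powr_numeral)
    also have "\<dots> \<le> 2 powr real w" using w by (intro powr_mono) auto
    also have "\<dots> = 2 ^ w" by (simp add: powr_realpow)
    finally show ?thesis by (simp flip: of_nat_le_iff[where 'a = real])
  qed
  have qn: "q \<le> 12 * n" using q12 n by auto
  note W = word_size_bounds[OF n(1,2) qn K2n nw]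
  have cube: "real (q * q * q) \<le> real P ^ 15"
  proof -
    have "q * q * q \<le> P ^ 5 * P ^ 5 * P ^ 5" by (intro mult_le_mono qP)
    also have "\<dots> = P ^ 15" by (simp flip: power_add)
    finally show ?thesis by (simp only: of_nat_le_iff flip: of_nat_power)
  qed
  have P2: "2 ^ k \<le> real P ^ k" for k by (intro power_mono) (auto simp: P_def)
  have "wp w scheme_program (\<lambda>t s. t \<le> 512 * (q * q * q * K * n) \<and> (\<exists>Fs. progress K r vs (q * K) s Fs))
      (input_state vs p)"
  proof (rule wp_scheme_program[where r = r and K = K], goal_cases)
    case 5
    show ?case using V by (auto simp: subset_iff)
  next
    case (13 t s Fs)
    have "t \<le> 512 * (q * q * q * K * n)"
      using 13(1) running_time_bound[OF q_def K0 K2n n(3)] unfolding q_def len by (rule le_trans)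
    with 13(2) show ?case unfolding q_def by blast
  qed (use r K W n in \<open>simp_all add: len q_def less_Suc_eq_le\<close>)
  then obtain t s Fs where ex: "exec w scheme_program (input_state vs p) t s"
    and t: "t \<le> 512 * (q * q * q * K * n)" and pr: "progress K r vs (q * K) s Fs"
    unfolding wp_def by blast
  let ?Qs = "queries vs q Fs"
  have lenF: "length Fs = q * K" using pr by (simp add: progress_def)
  have "query_scheme V p ?Qs"
    unfolding V(4)[symmetric] q_def
  proof (rule queries_query_scheme[where K = K and Z = "3 * K"])
    \<comment> \<open>The choice of \<open>q\<close> makes the \<open>q * K\<close> functions
      outnumber the at most \<open>2 * p * (3 * K)\<close> failing ones.\<close>
    have "6 * p * K < q * K" using r(1) K0 by (simp add: q_def)
    then show "2 * p * (3 * K) < length Fs" by (simp add: lenF)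
  qed (use pr V K len progress_zeros[OF pr] in \<open>auto simp: progress_def q_def\<close>)
  moreover have "outputs_family s ?Qs" using pr by (simp add: progress_def outs_def q_def)
  moreover have "real (length ?Qs) \<le> real P ^ 16 * L"
  proof -
    have "real (length ?Qs) = real (q * q * q) * real K" by (simp add: length_queries lenF)
    also have "\<dots> \<le> real P ^ 15 * (2 * L)" using cube KL by (intro mult_mono) auto
    also have "\<dots> \<le> real P ^ 15 * (real P * L)" using P2[of 1] L by (intro mult_left_mono mult_right_mono) auto
    also have "\<dots> = real P ^ 16 * L" by (simp add: eval_nat_numeral)
    finally show ?thesis .
  qed
  moreover have "real t \<le> real P ^ 25 * real n * L"
  proof -
    have "real t \<le> 512 * (real (q * q * q) * real K * real n)"
      using t by (simp flip: of_nat_le_iff[where 'a = real])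
    also have "\<dots> \<le> 512 * (real P ^ 15 * (2 * L) * real n)"
      using cube KL by (intro mult_left_mono mult_right_mono mult_mono) auto
    also have "\<dots> = 2 ^ 10 * (real P ^ 15 * real n * L)" by simp
    also have "\<dots> \<le> real P ^ 10 * (real P ^ 15 * real n * L)" using L by (intro mult_right_mono P2) auto
    also have "\<dots> = real P ^ (10 + 15) * real n * L" by (simp only: power_add mult.assoc)
    finally show ?thesis by simp
  qed
  ultimately show "\<exists>t s Qs. exec w scheme_program (input_state vs p) t s \<and> outputs_family s Qs \<and>
      query_scheme V p Qs \<and> real (length Qs) \<le> real (max 2 p) ^ 16 * log 2 (real n) \<and>
      real t \<le> real (max 2 p) ^ 25 * real n * log 2 (real n)"
    using ex unfolding P_def L_def by blast
qed

end
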